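(* Let $(Z_t)$ be a continuous-time Markov chain on a finite state space $\Sigma$ with transition rates $q(S,S')$, let $\Sigma_0 \subset \Sigma$ be a fixed subset, let $T := \inf\{t : Z_t \in \Sigma_0\}$, and assume that $h(S) := \mathbb{E}_S T < \infty$ for each $S \in \Sigma$. Assume also the monotonicity condition that $h(S') \le h(S)$ whenever $S \to S'$ is a possible transition. Fix an initial state not in $\Sigma_0$, and let $\mathbb{E}$ and $\mathrm{var}$ refer to the chain started there. For $\delta > 0$ define \[ q_\delta(S) := \sum_{S' : \ h(S) - h(S') > \delta\, \mathbb{E} T} q(S,S')\,(h(S) - h(S')). \] Then for arbitrary $\delta, \varepsilon > 0$, \[ \frac{\mathrm{var}\, T}{(\mathbb{E} T)^2} \le \delta + \varepsilon + \frac{\mathbb{E} \int_0^T \mathbf{1}_{\{q_\delta(Z_u) \ge \varepsilon\}}\, du}{\mathbb{E} T}. \]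
   Context: $\mathbb{E}_S$ denotes expectation for the chain started at state $S$. A transition $S \to S'$ (with $S \ne S'$) is possible if its transition rate $q(S,S')$ is strictly positive; sums over $S'$ are over states $S' \neq S$. *)

theory Defs
  imports "HOL-Probability.Probability"
begin

definition generator :: "('s \<Rightarrow> 's \<Rightarrow> real) \<Rightarrow> real ^ 's ^ 's" where
  "generator q = (\<chi> i j. if i = j then - (\<Sum>k\<in>UNIV - {i}. q i k) else q i j)"

text \<open>
  The entries of the transition semigroup \<open>exp (t Q)\<close> for the generator \<open>Q\<close>. The exponential
  series is written out entrywise since \<open>exp\<close> requires a normed algebra, which \<open>real ^ 's ^ 's\<close>
  with the matrix product is not; \<open>((**) Q ^^ n) (mat 1)\<close> is the \<open>n\<close>-th matrix power of \<open>Q\<close>.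
\<close>

definition transition_prob :: "('s::finite \<Rightarrow> 's \<Rightarrow> real) \<Rightarrow> real \<Rightarrow> 's \<Rightarrow> 's \<Rightarrow> real" where
  "transition_prob q t i j =
     (\<Sum>n. t ^ n / fact n * ((((**) (generator q)) ^^ n) (mat 1) $ i $ j))"

text \<open>
  A continuous-time Markov chain with rates \<open>q\<close> and initial state \<open>S\<close>, on the probability space
  \<open>M\<close>. Time is a nonnegative real: nothing is assumed about \<open>Z t\<close> for negative \<open>t\<close>. The diagonal
  values \<open>q S' S'\<close> are irrelevant. Right-continuity refers to the discrete topology on the states.
\<close>

locale ctmc = prob_space M
  for M :: "'w measure" and q :: "'s::finite \<Rightarrow> 's \<Rightarrow> real" and Z :: "real \<Rightarrow> 'w \<Rightarrow> 's" and S :: 's +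
  assumes rates_nonneg: "\<And>i j. i \<noteq> j \<Longrightarrow> 0 \<le> q i j"
    and measurable_state: "\<And>t. 0 \<le> t \<Longrightarrow> Z t \<in> measurable M (count_space UNIV)"
    and right_continuous:
      "\<And>\<omega> t. \<omega> \<in> space M \<Longrightarrow> 0 \<le> t \<Longrightarrow> eventually (\<lambda>u. Z u \<omega> = Z t \<omega>) (at_right t)"
    and initial_state: "AE \<omega> in M. Z 0 \<omega> = S"
    and markov:
      "\<And>(t :: nat \<Rightarrow> real) n x y. 0 \<le> t 0 \<Longrightarrow> (\<And>k. k \<le> n \<Longrightarrow> t k \<le> t (Suc k)) \<Longrightarrow>
       0 < \<P>(\<omega> in M. \<forall>k\<le>n. Z (t k) \<omega> = x k) \<Longrightarrow>
       \<P>(\<omega> in M. Z (t (Suc n)) \<omega> = y \<bar> \<forall>k\<le>n. Z (t k) \<omega> = x k)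
         = transition_prob q (t (Suc n) - t n) (x n) y"

text \<open>The value is \<open>\<infinity>\<close> if \<open>A\<close> is never hit, as \<open>Inf {} = \<infinity>\<close> in \<^typ>\<open>ennreal\<close>.\<close>

definition hitting_time :: "(real \<Rightarrow> 'w \<Rightarrow> 's) \<Rightarrow> 's set \<Rightarrow> 'w \<Rightarrow> ennreal" where
  "hitting_time Z A \<omega> = Inf {ennreal t |t. 0 \<le> t \<and> Z t \<omega> \<in> A}"

text \<open>
  The quantity written \<open>q\<^sub>\<delta>(S)\<close>; \<open>m\<close> is the mean hitting time from the chain's fixed initial
  state, not from \<open>S\<close>.
\<close>

definition large_drop_rate ::
    "('s::finite \<Rightarrow> 's \<Rightarrow> real) \<Rightarrow> ('s \<Rightarrow> real) \<Rightarrow> real \<Rightarrow> real \<Rightarrow> 's \<Rightarrow> real" where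
  "large_drop_rate q h m \<delta> S =
     (\<Sum>S' | S' \<noteq> S \<and> h S - h S' > \<delta> * m. q S S' * (h S - h S'))"

end

theory Submission
  imports Defs
begin

text \<open>
  Write \<open>p t i j\<close> for the probability that the chain started at \<open>i\<close> avoids the target set up to
  time \<open>t\<close> and is at \<open>j\<close> then (\<open>killed_prob\<close>). Approximating by finite grids of times, the Markov
  property makes \<open>p\<close> a semigroup, whose derivative at \<open>0\<close> off the target set is the generator
  \<open>Q\<close>. Let \<open>G\<close> be the integral of \<open>p\<close> over all times (\<open>green\<close>). Then \<open>G - \<integral>\<^sub>0\<^sup>r p = G p(r) = p(r) G\<close>,
  and dividing by \<open>r\<close> gives \<open>G Q = Q G = - I\<close> off the target set.

  By Tonelli, \<open>E T = h = G 1\<close> and \<open>E T\<^sup>2 = 2 G h\<close>. Now \<open>Q h = - 1\<close>, and with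
  \<open>a(S) = \<Sum> q(S,S') (h(S) - h(S'))\<^sup>2\<close> one has \<open>Q h\<^sup>2 = a - 2 h\<close>, so \<open>var T = 2 G h - h\<^sup>2 = G a\<close>.
  Splitting the jumps in \<open>a\<close> into drops of \<open>h\<close> below and above \<open>\<delta> E T\<close> gives the bound, as \<open>h\<close> never
  exceeds its initial value along the chain.
\<close>

section \<open>Grid approximation\<close>

text \<open>The chain is given only through its distributions at finitely many deterministic times,
  so there is no jump chain and no strong Markov property to invoke at \<open>T\<close>. Stopping
  enters through the killed semigroup alone; the rest is linear algebra with \<open>G\<close>. The
  delicate point is the derivative at 0: killing must cost only second order in the elapsed time,
  with a bound independent of the number of grid points, or it would not survive the refinement of
  the grids. The two one-sided inverses serve different ends. \<open>Q G = - I\<close> gives the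
  equation for \<open>h\<close>. \<open>G Q = - I\<close>, applied to a function vanishing on the
  target set, is Dynkin's formula at \<open>T\<close>; with \<open>h^2\<close> it gives the
  variance. The function \<open>a\<close> is the rate of quadratic variation of the martingale
  \<open>h(Z_t) + t\<close> stopped at \<open>T\<close>, which is why the variance is
  \<open>G a\<close>.\<close>

lemma matrix_power_entry_bound:
  fixes Q :: "real ^ 's::finite ^ 's"
  shows "\<bar>(((**) Q ^^ n) (mat 1)) $ i $ j\<bar> \<le> (\<Sum>a\<in>UNIV. \<Sum>b\<in>UNIV. \<bar>Q $ a $ b\<bar>) ^ n"
proof (induction n arbitrary: i)
  case 0
  show ?case by (simp add: mat_def)
next
  case (Suc n)
  let ?B = "\<Sum>a\<in>UNIV. \<Sum>b\<in>UNIV. \<bar>Q $ a $ b\<bar>"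
  have "\<bar>(((**) Q ^^ Suc n) (mat 1)) $ i $ j\<bar> \<le> (\<Sum>k\<in>UNIV. \<bar>Q $ i $ k\<bar> * \<bar>(((**) Q ^^ n) (mat 1)) $ k $ j\<bar>)"
    by (simp add: matrix_matrix_mult_def abs_mult[symmetric])
  also have "\<dots> \<le> (\<Sum>k\<in>UNIV. \<bar>Q $ i $ k\<bar> * ?B ^ n)"
    by (intro sum_mono mult_left_mono Suc) auto
  also have "\<dots> = (\<Sum>k\<in>UNIV. \<bar>Q $ i $ k\<bar>) * ?B ^ n"
    by (simp add: sum_distrib_right)
  also have "\<dots> \<le> ?B * ?B ^ n"
    by (intro mult_right_mono member_le_sum[where f = "\<lambda>a. \<Sum>b\<in>UNIV. \<bar>Q $ a $ b\<bar>"] zero_le_power sum_nonneg) auto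
  finally show ?case by simp
qed

text \<open>By \<open>matrix_power_entry_bound\<close> an exponential series dominates the entrywise
  power series, which therefore converges everywhere and may be differentiated termwise; at 0 only
  the coefficient of \<open>t\<close> survives.\<close>

lemma transition_prob_has_derivative_zero:
  "((\<lambda>t. transition_prob q t i j) has_real_derivative generator q $ i $ j) (at 0)"
proof -
  define c where "c n = (((**) (generator q) ^^ n) (mat 1)) $ i $ j / fact n" for n
  let ?B = "\<Sum>a\<in>UNIV. \<Sum>b\<in>UNIV. \<bar>generator q $ a $ b\<bar>"
  have summ: "summable (\<lambda>n. c n * x ^ n)" for x :: real
  proof (rule summable_comparison_test')
    show "summable (\<lambda>n. inverse (fact n) * (?B * \<bar>x\<bar>) ^ n)"
      by (rule summable_exp)
    show "norm (c n * x ^ n) \<le> inverse (fact n) * (?B * \<bar>x\<bar>) ^ n" for n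
      using mult_right_mono[OF matrix_power_entry_bound[where Q = "generator q" and n = n and i = i and j = j], of "\<bar>x\<bar> ^ n / fact n"]
      by (simp add: c_def abs_mult power_abs power_mult_distrib divide_simps)
  qed
  have "DERIV (\<lambda>x. \<Sum>n. c n * x ^ n) 0 :> (\<Sum>n. diffs c n * 0 ^ n)"
    by (rule termdiffs_strong[of _ 1]) (use summ[of 1] in auto)
  moreover have "(\<Sum>n. diffs c n * 0 ^ n) = generator q $ i $ j"
    by (subst powser_zero) (simp add: diffs_def c_def)
  moreover have "(\<lambda>x. \<Sum>n. c n * x ^ n) = (\<lambda>t. transition_prob q t i j)"
    by (simp add: transition_prob_def c_def mult.commute)
  ultimately show ?thesis by simp
qed

lemma transition_prob_zero: "transition_prob q 0 i j = of_bool (i = j)"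
proof -
  have "transition_prob q 0 i j = (\<Sum>n. (((**) (generator q) ^^ n) (mat 1)) $ i $ j / fact n * 0 ^ n)"
    by (simp add: transition_prob_def mult.commute)
  then show ?thesis
    using powser_zero[of "\<lambda>n. (((**) (generator q) ^^ n) (mat 1)) $ i $ j / fact n"]
    by (simp add: mat_def)
qed

section \<open>Detecting a hit along finite grids\<close>

text \<open>A path that is right-continuous for the discrete topology stays in the state of a hit at
  \<open>s < b\<close> for a positive time, and every sufficiently fine grid has a point in that
  time interval. The required fineness depends on the path.\<close>

lemma eventually_grid_iff:
  fixes z :: "real \<Rightarrow> 's"
  assumes rc: "\<And>t. 0 \<le> t \<Longrightarrow> eventually (\<lambda>u. z u = z t) (at_right t)" and "0 \<le> a" "a \<le> b"
  shows "eventually (\<lambda>n. (\<forall>k\<le>Suc n. z (a + real k * (b - a) / Suc n) \<notin> A) \<longleftrightarrow> (\<forall>s\<in>{a..b}. z s \<notin> A)) sequentially"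
proof (cases "\<forall>s\<in>{a..b}. z s \<notin> A")
  case True
  have "a + real k * (b - a) / Suc n \<in> {a..b}" if "k \<le> Suc n" for k n
  proof -
    have "real k * (b - a) \<le> Suc n * (b - a)"
      using that assms by (intro mult_right_mono) auto
    then have "real k * (b - a) / Suc n \<le> b - a"
      by (simp add: divide_simps mult.commute)
    then show ?thesis using assms by auto
  qed
  then show ?thesis using True by (intro always_eventually) blast
next
  case False
  then obtain s where s: "a \<le> s" "s \<le> b" "z s \<in> A" by auto
  show ?thesis
  proof (cases "s = b")
    case True
    \<comment> \<open>Right-continuity says nothing inside \<open>[a, b]\<close> about a hit at
      \<open>b\<close>, but \<open>b\<close> is the last point of every grid.\<close>
    then have "z (a + real (Suc n) * (b - a) / Suc n) \<in> A" for n
      using s by simp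
    then show ?thesis using s False by (intro always_eventually) blast
  next
    case neq: False
    with s have "s < b" "a < b" by auto
    obtain d where d: "s < d" "\<And>y. s < y \<Longrightarrow> y < d \<Longrightarrow> z y = z s"
      using rc[of s] s \<open>0 \<le> a\<close> unfolding eventually_at_right_field by auto
    have "eventually (\<lambda>n. (b - a) / Suc n < d - s) sequentially"
    proof (rule order_tendstoD)
      show "(\<lambda>n. (b - a) / Suc n) \<longlonglongrightarrow> 0"
        using tendsto_mult_left[OF LIMSEQ_inverse_real_of_nat, of "b - a"] by (simp add: divide_inverse)
    qed (use d in auto)
    then show ?thesis
    proof eventually_elim
      case (elim n)
      define w where "w = (b - a) / Suc n"
      have w: "0 < w" "w < d - s" "Suc n * w = b - a"
        using \<open>a < b\<close> elim by (auto simp: w_def)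
      \<comment> \<open>Index of the first grid point at or after \<open>s\<close>; it lies in
        \<open>[s, s + w)\<close>, hence before \<open>d\<close>.\<close>
      define k where "k = nat \<lceil>(s - a) / w\<rceil>"
      have k: "(s - a) / w \<le> real k" "real k < (s - a) / w + 1"
        using s w unfolding k_def by (auto simp: ceiling_correct of_nat_nat) linarith
      have "(s - a) / w \<le> Suc n"
        using w s by (simp add: divide_simps)
      then have "k \<le> Suc n"
        unfolding k_def by (simp add: nat_le_iff ceiling_le_iff)
      moreover have "s \<le> a + k * w" "a + k * w < s + w"
        using k w by (auto simp: field_simps)
      then have "z (a + k * w) = z s"
        using d(2)[of "a + k * w"] w by (cases "s = a + k * w") auto
      ultimately show ?case
        using s False unfolding w_def by (metis times_divide_eq_right)
    qed
  qed
qed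

section \<open>Grid probabilities as products of killed transition matrices\<close>

text \<open>The product of the transition matrices over the grid increments, with a projection onto
  the complement of \<open>A\<close> inserted at every grid point. It sees only the increments of
  \<open>t\<close>, so a grid may be restarted at any of its points.\<close>

primrec killed_grid ::
    "('s::finite \<Rightarrow> 's \<Rightarrow> real) \<Rightarrow> 's set \<Rightarrow> (nat \<Rightarrow> real) \<Rightarrow> nat \<Rightarrow> 's \<Rightarrow> 's \<Rightarrow> real" where
  "killed_grid q A t 0 i j = of_bool (i = j \<and> i \<notin> A)"
| "killed_grid q A t (Suc n) i j =
     of_bool (j \<notin> A) * (\<Sum>x\<in>UNIV. killed_grid q A t n i x * transition_prob q (t (Suc n) - t n) x j)"

lemma killed_grid_eq_0: "j \<in> A \<Longrightarrow> killed_grid q A t n i j = 0"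
  by (cases n) auto

lemma killed_grid_cong:
  assumes "\<And>k. k < n \<Longrightarrow> t (Suc k) - t k = t' (Suc k) - t' k"
  shows "killed_grid q A t n i j = killed_grid q A t' n i j"
  using assms by (induction n arbitrary: j) auto

lemma killed_grid_add:
  "killed_grid q A t (m + n) i j = (\<Sum>x\<in>UNIV. killed_grid q A t m i x * killed_grid q A (\<lambda>k. t (m + k)) n x j)"
proof (induction n arbitrary: j)
  case 0
  \<comment> \<open>The second block opens with another projection at the junction point; after the
    first block it changes nothing.\<close>
  have "(\<Sum>x\<in>UNIV. killed_grid q A t m i x * of_bool (x = j \<and> x \<notin> A))
      = (\<Sum>x\<in>UNIV. if x = j then killed_grid q A t m i j else 0)"
    by (intro sum.cong refl) (auto simp: killed_grid_eq_0)
  then show ?case by simp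
next
  case (Suc n)
  show ?case
    by (simp add: Suc sum_distrib_left sum_distrib_right mult_ac) (rule impI, rule sum.swap)
qed

lemma nonneg_if_stepwise_mono:
  fixes t :: "nat \<Rightarrow> real"
  assumes "0 \<le> t 0" "\<And>k. k < n \<Longrightarrow> t k \<le> t (Suc k)" "k \<le> n"
  shows "0 \<le> t k"
  using assms(3)
proof (induction k)
  case (Suc k)
  then show ?case using assms(2)[of k] by simp
qed (rule assms(1))

context ctmc
begin

lemma prob_initial: "prob {\<omega> \<in> space M. Z 0 \<omega> = j} = of_bool (S = j)"
proof -
  have [measurable]: "Z 0 \<in> measurable M (count_space UNIV)"
    using measurable_state by auto
  have meas: "{\<omega> \<in> space M. Z 0 \<omega> = j} \<in> sets M" by measurable
  show ?thesis
  proof (cases "S = j")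
    case True
    have "AE \<omega> in M. \<omega> \<in> {\<omega> \<in> space M. Z 0 \<omega> = j}"
      using initial_state AE_space by eventually_elim (use True in auto)
    then show ?thesis using True by (simp add: prob_eq_1[OF meas])
  next
    case False
    have "AE \<omega> in M. \<omega> \<notin> {\<omega> \<in> space M. Z 0 \<omega> = j}"
      using initial_state AE_space by eventually_elim (use False in auto)
    then show ?thesis using False by (simp add: prob_eq_0[OF meas])
  qed
qed

text \<open>\<open>markov\<close> conditions on one exact history, whereas here the past is an
  avoidance event. That event is a finite disjoint union of histories ending in \<open>x\<close>,
  and all of them share the same transition factor.\<close>

lemma grid_markov:
  assumes "0 \<le> t 0" and "\<And>k. k \<le> n \<Longrightarrow> t k \<le> t (Suc k)"
  shows "prob {\<omega> \<in> space M. (\<forall>k\<le>n. Z (t k) \<omega> \<notin> A) \<and> Z (t n) \<omega> = x \<and> Z (t (Suc n)) \<omega> = y}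
    = prob {\<omega> \<in> space M. (\<forall>k\<le>n. Z (t k) \<omega> \<notin> A) \<and> Z (t n) \<omega> = x}
        * transition_prob q (t (Suc n) - t n) x y"
proof -
  have t0: "0 \<le> t k" if "k \<le> Suc n" for k
    by (rule nonneg_if_stepwise_mono[of t "Suc n"]) (use assms that in auto)
  have [measurable]: "Z (t k) \<in> measurable M (count_space UNIV)" if "k \<le> Suc n" for k
    using measurable_state t0 that by auto
  \<comment> \<open>Extensional functions on \<open>{..n}\<close>: this makes the set of histories
    finite and distinct histories incompatible.\<close>
  define X where "X = {f \<in> PiE {..n} (\<lambda>_. - A). f n = x}"
  have fin: "finite X"
    unfolding X_def by (auto intro!: finite_subset[OF _ finite_PiE[of "{..n}" "\<lambda>_. - A"]])
  define D where "D f = {\<omega> \<in> space M. \<forall>k\<le>n. Z (t k) \<omega> = f k}" for f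
  define E where "E = {\<omega> \<in> space M. Z (t (Suc n)) \<omega> = y}"
  have meas: "D f \<in> sets M" "E \<in> sets M" for f
  proof -
    have "D f = (\<Inter>k\<le>n. {\<omega> \<in> space M. Z (t k) \<omega> = f k})"
      unfolding D_def by (auto dest: bspec[of _ _ 0])
    also have "\<dots> \<in> sets M" by (intro sets.finite_INT) auto
    finally show "D f \<in> sets M" .
    show "E \<in> sets M" unfolding E_def by measurable
  qed
  have disj: "disjoint_family_on D X"
    unfolding disjoint_family_on_def
  proof (intro ballI impI)
    fix f g assume fg: "f \<in> X" "g \<in> X" "f \<noteq> g"
    have "\<exists>k\<le>n. f k \<noteq> g k"
    proof (rule ccontr)
      assume "\<not> (\<exists>k\<le>n. f k \<noteq> g k)"
      then have "f = g"
        using fg(1,2) unfolding X_def by (intro PiE_ext[of f "{..n}" "\<lambda>_. - A" g]) auto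
      then show False using fg by simp
    qed
    then obtain k where "k \<le> n" "f k \<noteq> g k" by blast
    then show "D f \<inter> D g = {}" unfolding D_def by auto
  qed
  have eq: "{\<omega> \<in> space M. (\<forall>k\<le>n. Z (t k) \<omega> \<notin> A) \<and> Z (t n) \<omega> = x} = (\<Union>f\<in>X. D f)"
  proof (intro equalityI subsetI)
    fix \<omega> assume w: "\<omega> \<in> {\<omega> \<in> space M. (\<forall>k\<le>n. Z (t k) \<omega> \<notin> A) \<and> Z (t n) \<omega> = x}"
    then show "\<omega> \<in> (\<Union>f\<in>X. D f)"
      by (intro UN_I[of "restrict (\<lambda>k. Z (t k) \<omega>) {..n}"]) (auto simp: X_def D_def)
  qed (auto simp: X_def D_def)
  have eq2: "{\<omega> \<in> space M. (\<forall>k\<le>n. Z (t k) \<omega> \<notin> A) \<and> Z (t n) \<omega> = x \<and> Z (t (Suc n)) \<omega> = y}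
    = (\<Union>f\<in>X. D f \<inter> E)"
    using eq unfolding E_def by auto
  have step: "prob (D f \<inter> E) = prob (D f) * transition_prob q (t (Suc n) - t n) x y" if "f \<in> X" for f
  proof (cases "prob (D f) = 0")
    \<comment> \<open>The Markov assumption covers only histories of positive probability; for a
      null history both sides vanish.\<close>
    case True
    have "prob (D f \<inter> E) \<le> prob (D f)"
      using meas by (intro finite_measure_mono) auto
    then show ?thesis using True measure_nonneg[of M "D f \<inter> E"] by simp
  next
    case False
    then have "0 < prob (D f)" by (simp add: zero_less_measure_iff)
    then have "\<P>(\<omega> in M. Z (t (Suc n)) \<omega> = y \<bar> \<forall>k\<le>n. Z (t k) \<omega> = f k)
         = transition_prob q (t (Suc n) - t n) (f n) y"
      using assms unfolding D_def by (intro markov)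
    moreover have "f n = x" using that unfolding X_def by auto
    moreover have "{\<omega> \<in> space M. Z (t (Suc n)) \<omega> = y \<and> (\<forall>k\<le>n. Z (t k) \<omega> = f k)} = D f \<inter> E"
      unfolding D_def E_def by auto
    ultimately show ?thesis using False
      by (simp add: cond_prob_def D_def[symmetric] field_simps)
  qed
  have "prob (\<Union>f\<in>X. D f \<inter> E) = (\<Sum>f\<in>X. prob (D f \<inter> E))"
    using meas fin disj by (intro finite_measure_finite_Union) (auto simp: disjoint_family_on_def)
  moreover have "prob (\<Union>f\<in>X. D f) = (\<Sum>f\<in>X. prob (D f))"
    using meas fin disj by (intro finite_measure_finite_Union) auto
  ultimately show ?thesis
    unfolding eq eq2 by (simp add: step sum_distrib_right)
qed

lemma prob_partition_state:
  assumes "0 \<le> t" and "{\<omega> \<in> space M. R \<omega>} \<in> sets M"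
  shows "prob {\<omega> \<in> space M. R \<omega>} = (\<Sum>x\<in>UNIV. prob {\<omega> \<in> space M. R \<omega> \<and> Z t \<omega> = x})"
proof -
  have [measurable]: "Z t \<in> measurable M (count_space UNIV)"
    using measurable_state assms by auto
  have "{\<omega> \<in> space M. R \<omega> \<and> Z t \<omega> = x} \<in> sets M" for x
    using assms(2) by (intro sets.sets_Collect_conj) auto
  then have "prob (\<Union>x\<in>UNIV. {\<omega> \<in> space M. R \<omega> \<and> Z t \<omega> = x}) = (\<Sum>x\<in>UNIV. prob {\<omega> \<in> space M. R \<omega> \<and> Z t \<omega> = x})"
    by (intro finite_measure_finite_Union) (auto simp: disjoint_family_on_def)
  moreover have "(\<Union>x\<in>UNIV. {\<omega> \<in> space M. R \<omega> \<and> Z t \<omega> = x}) = {\<omega> \<in> space M. R \<omega>}"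
    by auto
  ultimately show ?thesis by simp
qed

lemma sets_grid:
  fixes n :: nat
  assumes "\<And>k. k \<le> n \<Longrightarrow> 0 \<le> t k"
  shows "{\<omega> \<in> space M. \<forall>k\<le>n. Z (t k) \<omega> \<notin> A} \<in> sets M"
proof -
  have "{\<omega> \<in> space M. \<forall>k\<in>{..n}. Z (t k) \<omega> \<notin> A} \<in> sets M"
  proof (rule sets.sets_Collect_finite_All)
    fix k assume "k \<in> {..n}"
    then have "Z (t k) \<in> measurable M (count_space UNIV)"
      using measurable_state assms by auto
    then have "Z (t k) -` (- A) \<inter> space M \<in> sets M"
      by (rule measurable_sets) simp
    also have "Z (t k) -` (- A) \<inter> space M = {\<omega> \<in> space M. Z (t k) \<omega> \<notin> A}"
      by auto
    finally show "{\<omega> \<in> space M. Z (t k) \<omega> \<notin> A} \<in> sets M" .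
  qed simp
  then show ?thesis by (simp only: Ball_def atMost_iff)
qed

text \<open>Peel off the last grid time: split by the state at the previous grid point and apply
  \<open>grid_markov\<close>. The grid starts at 0 because that is where the law of the state is
  known.\<close>

lemma prob_grid:
  assumes "t 0 = 0" and "\<And>k. k < n \<Longrightarrow> t k \<le> t (Suc k)"
  shows "prob {\<omega> \<in> space M. (\<forall>k\<le>n. Z (t k) \<omega> \<notin> A) \<and> Z (t n) \<omega> = j} = killed_grid q A t n S j"
  using assms
proof (induction n arbitrary: j)
  case 0
  show ?case
  proof (cases "j \<in> A")
    case True
    then have "{\<omega> \<in> space M. Z 0 \<omega> \<notin> A \<and> Z 0 \<omega> = j} = {}" by auto
    then have "prob {\<omega> \<in> space M. Z 0 \<omega> \<notin> A \<and> Z 0 \<omega> = j} = 0" by (simp only: measure_empty)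
    then show ?thesis using True 0 by auto
  next
    case False
    then have "{\<omega> \<in> space M. Z 0 \<omega> \<notin> A \<and> Z 0 \<omega> = j} = {\<omega> \<in> space M. Z 0 \<omega> = j}" by auto
    then show ?thesis using False 0 prob_initial[of j] by auto
  qed
next
  case (Suc n)
  have t0: "0 \<le> t k" if "k \<le> Suc n" for k
    by (rule nonneg_if_stepwise_mono[of t "Suc n"]) (use Suc.prems that in auto)
  have [measurable]: "Z (t (Suc n)) \<in> measurable M (count_space UNIV)"
    using measurable_state t0 by auto
  show ?case
  proof (cases "j \<in> A")
    case True
    then have "{\<omega> \<in> space M. (\<forall>k\<le>Suc n. Z (t k) \<omega> \<notin> A) \<and> Z (t (Suc n)) \<omega> = j} = {}" by auto
    then show ?thesis using True by (simp only:) simp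
  next
    case False
    have eq: "{\<omega> \<in> space M. (\<forall>k\<le>Suc n. Z (t k) \<omega> \<notin> A) \<and> Z (t (Suc n)) \<omega> = j}
      = {\<omega> \<in> space M. (\<forall>k\<le>n. Z (t k) \<omega> \<notin> A) \<and> Z (t (Suc n)) \<omega> = j}"
      using False by (auto simp: le_Suc_eq)
    have "{\<omega> \<in> space M. (\<forall>k\<le>n. Z (t k) \<omega> \<notin> A) \<and> Z (t (Suc n)) \<omega> = j} \<in> sets M"
    proof -
      have "{\<omega> \<in> space M. Z (t (Suc n)) \<omega> = j} \<in> sets M"
        by measurable
      moreover have "{\<omega> \<in> space M. \<forall>k\<le>n. Z (t k) \<omega> \<notin> A} \<in> sets M"
        by (rule sets_grid) (simp add: t0)
      ultimately show ?thesis by (rule sets.sets_Collect_conj)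
    qed
    then have "prob {\<omega> \<in> space M. (\<forall>k\<le>n. Z (t k) \<omega> \<notin> A) \<and> Z (t (Suc n)) \<omega> = j}
      = (\<Sum>x\<in>UNIV. prob {\<omega> \<in> space M. ((\<forall>k\<le>n. Z (t k) \<omega> \<notin> A) \<and> Z (t (Suc n)) \<omega> = j) \<and> Z (t n) \<omega> = x})"
      by (rule prob_partition_state[where t = "t n", rotated]) (simp add: t0)
    also have "\<dots> = (\<Sum>x\<in>UNIV. prob {\<omega> \<in> space M. (\<forall>k\<le>n. Z (t k) \<omega> \<notin> A) \<and> Z (t n) \<omega> = x \<and> Z (t (Suc n)) \<omega> = j})"
      by (intro sum.cong refl arg_cong[where f = prob]) auto
    also have "\<dots> = (\<Sum>x\<in>UNIV. killed_grid q A t n S x * transition_prob q (t (Suc n) - t n) x j)"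
    proof (intro sum.cong refl)
      fix x
      have "prob {\<omega> \<in> space M. (\<forall>k\<le>n. Z (t k) \<omega> \<notin> A) \<and> Z (t n) \<omega> = x} = killed_grid q A t n S x"
        by (rule Suc.IH) (use Suc.prems in auto)
      moreover have "prob {\<omega> \<in> space M. (\<forall>k\<le>n. Z (t k) \<omega> \<notin> A) \<and> Z (t n) \<omega> = x \<and> Z (t (Suc n)) \<omega> = j}
        = prob {\<omega> \<in> space M. (\<forall>k\<le>n. Z (t k) \<omega> \<notin> A) \<and> Z (t n) \<omega> = x} * transition_prob q (t (Suc n) - t n) x j"
        by (rule grid_markov) (use Suc.prems in auto)
      ultimately show "prob {\<omega> \<in> space M. (\<forall>k\<le>n. Z (t k) \<omega> \<notin> A) \<and> Z (t n) \<omega> = x \<and> Z (t (Suc n)) \<omega> = j}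
        = killed_grid q A t n S x * transition_prob q (t (Suc n) - t n) x j"
        by (simp only:)
    qed
    finally show ?thesis using eq False by simp
  qed
qed

text \<open>With \<open>A\<close> empty nothing is killed, and the grid \<open>0, t\<close> leaves a
  single transition.\<close>

lemma prob_state:
  assumes "0 \<le> t"
  shows "prob {\<omega> \<in> space M. Z t \<omega> = j} = transition_prob q t S j"
  using prob_grid[of "\<lambda>k. real k * t" 1 "{}" j] assms
  by (simp add: sum_of_bool_mult_eq le_Suc_eq)

text \<open>The condition involves uncountably many times. Path by path it agrees with all
  sufficiently fine grid events, so it is their limit inferior.\<close>

lemma sets_no_hit:
  assumes "0 \<le> a" "a \<le> b"
  shows "{\<omega> \<in> space M. \<forall>s\<in>{a..b}. Z s \<omega> \<notin> A} \<in> sets M"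
proof -
  define E where "E n = {\<omega> \<in> space M. \<forall>k\<le>Suc n. Z (a + real k * (b - a) / Suc n) \<omega> \<notin> A}" for n :: nat
  have 1: "E n \<in> sets M" for n
    unfolding E_def by (rule sets_grid[where t = "\<lambda>k. a + real k * (b - a) / Suc n"]) (use assms in auto)
  have "{\<omega> \<in> space M. \<forall>s\<in>{a..b}. Z s \<omega> \<notin> A} = (\<Union>m. \<Inter>n\<in>{m..}. E n)"
  proof (intro set_eqI)
    fix \<omega>
    show "\<omega> \<in> {\<omega> \<in> space M. \<forall>s\<in>{a..b}. Z s \<omega> \<notin> A} \<longleftrightarrow> \<omega> \<in> (\<Union>m. \<Inter>n\<in>{m..}. E n)"
    proof (cases "\<omega> \<in> space M")
      case True
      then have "eventually (\<lambda>n. \<omega> \<in> E n \<longleftrightarrow> (\<forall>s\<in>{a..b}. Z s \<omega> \<notin> A)) sequentially"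
        using eventually_grid_iff[OF right_continuous assms, of \<omega> A] by (simp add: E_def)
      then obtain N where N: "\<And>n. n \<ge> N \<Longrightarrow> \<omega> \<in> E n \<longleftrightarrow> (\<forall>s\<in>{a..b}. Z s \<omega> \<notin> A)"
        unfolding eventually_sequentially by blast
      have "(\<exists>m. \<forall>n\<ge>m. \<omega> \<in> E n) \<longleftrightarrow> (\<forall>s\<in>{a..b}. Z s \<omega> \<notin> A)"
        using N by (meson nle_le)
      moreover have "\<omega> \<in> (\<Union>m. \<Inter>n\<in>{m..}. E n) \<longleftrightarrow> (\<exists>m. \<forall>n\<ge>m. \<omega> \<in> E n)"
        by (simp only: UN_iff INT_iff) auto
      ultimately show ?thesis using True by simp
    qed (auto simp: E_def)
  qed
  also have "\<dots> \<in> sets M"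
    by (intro sets.countable_UN sets.countable_INT image_subsetI 1) auto
  finally show ?thesis .
qed

end

section \<open>The killed semigroup\<close>

text \<open>Dominated convergence for indicators. The index from which the events agree may depend
  on the sample point, which is all that \<open>eventually_grid_iff\<close> provides.\<close>

lemma (in prob_space) prob_tendsto:
  assumes [measurable]: "\<And>n. E n \<in> sets M" "F \<in> sets M"
    and lim: "\<And>\<omega>. \<omega> \<in> space M \<Longrightarrow> eventually (\<lambda>n. \<omega> \<in> E n \<longleftrightarrow> \<omega> \<in> F) sequentially"
  shows "(\<lambda>n. prob (E n)) \<longlonglongrightarrow> prob F"
proof -
  have "(\<lambda>n. integral\<^sup>L M (indicat_real (E n))) \<longlonglongrightarrow> integral\<^sup>L M (indicat_real F)"
  proof (rule integral_dominated_convergence[where w = "\<lambda>_. 1"])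
    show "AE \<omega> in M. (\<lambda>n. indicat_real (E n) \<omega>) \<longlonglongrightarrow> indicat_real F \<omega>"
    proof (rule AE_I2)
      fix \<omega> assume "\<omega> \<in> space M"
      from lim[OF this] have "eventually (\<lambda>n. indicat_real (E n) \<omega> = indicat_real F \<omega>) sequentially"
        by eventually_elim (auto simp: indicator_def)
      then show "(\<lambda>n. indicat_real (E n) \<omega>) \<longlonglongrightarrow> indicat_real F \<omega>"
        by (rule tendsto_eventually)
    qed
  qed (auto simp: indicator_def)
  then show ?thesis by simp
qed

locale ctmc_family =
  fixes P :: "'s::finite \<Rightarrow> 'w measure" and q :: "'s \<Rightarrow> 's \<Rightarrow> real"
    and Z :: "real \<Rightarrow> 'w \<Rightarrow> 's" and A :: "'s set"
  assumes chain: "\<And>S. ctmc (P S) q Z S"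
begin

definition killed_prob :: "real \<Rightarrow> 's \<Rightarrow> 's \<Rightarrow> real" where
  "killed_prob t i j = measure (P i) {\<omega> \<in> space (P i). (\<forall>s\<in>{0..t}. Z s \<omega> \<notin> A) \<and> Z t \<omega> = j}"

lemma sets_no_hit_state:
  assumes "0 \<le> t"
  shows "{\<omega> \<in> space (P i). (\<forall>s\<in>{0..t}. Z s \<omega> \<notin> A) \<and> Z t \<omega> = j} \<in> sets (P i)"
proof -
  interpret ctmc "P i" q Z i by (rule chain)
  have [measurable]: "Z t \<in> measurable (P i) (count_space UNIV)"
    using measurable_state assms by auto
  have "{\<omega> \<in> space (P i). Z t \<omega> = j} \<in> sets (P i)" by measurable
  moreover have "{\<omega> \<in> space (P i). \<forall>s\<in>{0..t}. Z s \<omega> \<notin> A} \<in> sets (P i)"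
    by (rule sets_no_hit) (use assms in auto)
  ultimately show ?thesis by (rule sets.sets_Collect_conj)
qed

lemma sets_grid_state:
  fixes n :: nat
  assumes "\<And>k. k \<le> n \<Longrightarrow> 0 \<le> t k"
  shows "{\<omega> \<in> space (P i). (\<forall>k\<le>n. Z (t k) \<omega> \<notin> A) \<and> Z (t n) \<omega> = j} \<in> sets (P i)"
proof -
  interpret ctmc "P i" q Z i by (rule chain)
  have [measurable]: "Z (t n) \<in> measurable (P i) (count_space UNIV)"
    using measurable_state assms by auto
  have "{\<omega> \<in> space (P i). Z (t n) \<omega> = j} \<in> sets (P i)" by measurable
  moreover have "{\<omega> \<in> space (P i). \<forall>k\<le>n. Z (t k) \<omega> \<notin> A} \<in> sets (P i)"
    by (rule sets_grid) (use assms in auto)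
  ultimately show ?thesis by (rule sets.sets_Collect_conj)
qed

lemma killed_grid_tendsto:
  assumes t: "0 \<le> t"
  shows "(\<lambda>n. killed_grid q A (\<lambda>k. real k * t / Suc n) (Suc n) i j) \<longlonglongrightarrow> killed_prob t i j"
proof -
  interpret ctmc "P i" q Z i by (rule chain)
  let ?g = "\<lambda>n k. real k * t / Suc n"
  have "(\<lambda>n. prob {\<omega> \<in> space (P i). (\<forall>k\<le>Suc n. Z (?g n k) \<omega> \<notin> A) \<and> Z (?g n (Suc n)) \<omega> = j})
      \<longlonglongrightarrow> killed_prob t i j"
    unfolding killed_prob_def
  proof (rule prob_tendsto)
    fix n
    show "{\<omega> \<in> space (P i). (\<forall>k\<le>Suc n. Z (?g n k) \<omega> \<notin> A) \<and> Z (?g n (Suc n)) \<omega> = j} \<in> sets (P i)"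
      by (rule sets_grid_state[where t = "?g n"]) (use t in auto)
  next
    show "{\<omega> \<in> space (P i). (\<forall>s\<in>{0..t}. Z s \<omega> \<notin> A) \<and> Z t \<omega> = j} \<in> sets (P i)"
      by (rule sets_no_hit_state[OF t])
  next
    fix \<omega> assume w: "\<omega> \<in> space (P i)"
    have grid: "eventually (\<lambda>n. (\<forall>k\<le>Suc n. Z (a + real k * (b - a) / Suc n) \<omega> \<notin> A) \<longleftrightarrow> (\<forall>s\<in>{a..b}. Z s \<omega> \<notin> A)) sequentially"
      if "0 \<le> a" "a \<le> b" for a b
      by (rule eventually_grid_iff) (use right_continuous w that in auto)
    \<comment> \<open>The last grid point is always \<open>t\<close>, so only the avoidance part of
      the event varies with \<open>n\<close>.\<close>
    have "?g n (Suc n) = t" for n by simp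
    with grid[OF order_refl t]
    show "eventually (\<lambda>n. \<omega> \<in> {\<omega> \<in> space (P i). (\<forall>k\<le>Suc n. Z (?g n k) \<omega> \<notin> A) \<and> Z (?g n (Suc n)) \<omega> = j}
       \<longleftrightarrow> \<omega> \<in> {\<omega> \<in> space (P i). (\<forall>s\<in>{0..t}. Z s \<omega> \<notin> A) \<and> Z t \<omega> = j}) sequentially"
      by (simp only: mem_Collect_eq diff_zero add_0) (auto elim!: eventually_mono)
  qed
  moreover have "prob {\<omega> \<in> space (P i). (\<forall>k\<le>Suc n. Z (?g n k) \<omega> \<notin> A) \<and> Z (?g n (Suc n)) \<omega> = j}
    = killed_grid q A (?g n) (Suc n) i j" for n
    by (rule prob_grid) (use t in \<open>auto intro!: divide_right_mono mult_right_mono\<close>)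
  ultimately show ?thesis by (simp only:)
qed

text \<open>Both sides are limits along a grid on \<open>[0, u]\<close> followed by a grid on \<open>[u, u + v]\<close>.\<close>

lemma killed_prob_add:
  assumes u: "0 \<le> u" and v: "0 \<le> v"
  shows "killed_prob (u + v) i j = (\<Sum>x\<in>UNIV. killed_prob u i x * killed_prob v x j)"
proof -
  interpret ctmc "P i" q Z i by (rule chain)
  \<comment> \<open>A uniform grid on \<open>[0, u + v]\<close> would in general miss
    \<open>u\<close>; with \<open>u\<close> as a grid point the matrix product factors there
    exactly.\<close>
  define g where "g n k = (if k \<le> Suc n then real k * u / Suc n else u + (real k - Suc n) * v / Suc n)"
    for n k :: nat
  let ?N = "\<lambda>n. Suc n + Suc n"
  have g_first: "g n k = 0 + real k * (u - 0) / Suc n" if "k \<le> Suc n" for n k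
    using that by (simp add: g_def)
  have g_second: "g n (Suc n + k) = u + real k * (u + v - u) / Suc n" for n k
    by (cases "k = 0") (simp_all add: g_def)
  have g_end: "g n (?N n) = u + v" for n
    unfolding g_second by simp
  have g_diff_first: "g n (Suc k) - g n k = real (Suc k) * u / Suc n - real k * u / Suc n" if "k < Suc n" for n k
    using that by (simp add: g_def)
  have g_diff_second: "g n (Suc n + Suc k) - g n (Suc n + k) = real (Suc k) * v / Suc n - real k * v / Suc n" for n k
    unfolding g_second by simp
  have g_mono: "g n k \<le> g n (Suc k)" for n k
  proof (cases "k < Suc n")
    case True
    have "real k * u / Suc n \<le> real (Suc k) * u / Suc n"
      using u by (intro divide_right_mono mult_right_mono) auto
    then show ?thesis using g_diff_first[OF True] by linarith
  next
    case False
    then obtain m where m: "k = Suc n + m" using le_Suc_ex[of "Suc n" k] by auto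
    have "real m * v / Suc n \<le> real (Suc m) * v / Suc n"
      using v by (intro divide_right_mono mult_right_mono) auto
    then show ?thesis using g_diff_second[of n m] m by simp
  qed
  have g0: "g n 0 = 0" for n by (simp add: g_def)
  have gnn: "0 \<le> g n k" for n k
    by (rule nonneg_if_stepwise_mono[of _ k]) (use g0 g_mono in auto)
  have "(\<lambda>n. prob {\<omega> \<in> space (P i). (\<forall>k\<le>?N n. Z (g n k) \<omega> \<notin> A) \<and> Z (g n (?N n)) \<omega> = j})
      \<longlonglongrightarrow> killed_prob (u + v) i j"
    unfolding killed_prob_def
  proof (rule prob_tendsto)
    fix n
    show "{\<omega> \<in> space (P i). (\<forall>k\<le>?N n. Z (g n k) \<omega> \<notin> A) \<and> Z (g n (?N n)) \<omega> = j} \<in> sets (P i)"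
      by (rule sets_grid_state) (rule gnn)
  next
    show "{\<omega> \<in> space (P i). (\<forall>s\<in>{0..u+v}. Z s \<omega> \<notin> A) \<and> Z (u + v) \<omega> = j} \<in> sets (P i)"
      by (rule sets_no_hit_state) (use u v in auto)
  next
    fix \<omega> assume w: "\<omega> \<in> space (P i)"
    have grid: "eventually (\<lambda>n. (\<forall>k\<le>Suc n. Z (a + real k * (b - a) / Suc n) \<omega> \<notin> A) \<longleftrightarrow> (\<forall>s\<in>{a..b}. Z s \<omega> \<notin> A)) sequentially"
      if "0 \<le> a" "a \<le> b" for a b
      by (rule eventually_grid_iff) (use right_continuous w that in auto)
    have split: "(\<forall>k\<le>?N n. Z (g n k) \<omega> \<notin> A) \<longleftrightarrow>
       (\<forall>k\<le>Suc n. Z (0 + real k * (u - 0) / Suc n) \<omega> \<notin> A) \<and>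
       (\<forall>k\<le>Suc n. Z (u + real k * (u + v - u) / Suc n) \<omega> \<notin> A)" (is "?L \<longleftrightarrow> ?R1 \<and> ?R2") for n
    proof
      assume L: ?L
      have "Z (0 + real k * (u - 0) / Suc n) \<omega> \<notin> A" if "k \<le> Suc n" for k
        using L[rule_format, of k] that unfolding g_first[OF that] by simp
      moreover have "Z (u + real k * (u + v - u) / Suc n) \<omega> \<notin> A" if "k \<le> Suc n" for k
        using L[rule_format, of "Suc n + k"] that unfolding g_second by simp
      ultimately show "?R1 \<and> ?R2" by blast
    next
      assume R: "?R1 \<and> ?R2"
      show ?L
      proof (intro allI impI)
        fix k assume k: "k \<le> ?N n"
        show "Z (g n k) \<omega> \<notin> A"
        proof (cases "k \<le> Suc n")
          case True
          then show ?thesis using R unfolding g_first[OF True] by blast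
        next
          case False
          then obtain m where m: "k = Suc n + m" using le_Suc_ex[of "Suc n" k] by auto
          then have "m \<le> Suc n" using k by simp
          then show ?thesis using R unfolding m g_second by blast
        qed
      qed
    qed
    have union: "{0..u} \<union> {u..u+v} = {0..u+v}" using u v by auto
    have "u \<le> u + v" using v by simp
    from grid[OF order_refl u] grid[OF u this]
    show "eventually (\<lambda>n. \<omega> \<in> {\<omega> \<in> space (P i). (\<forall>k\<le>?N n. Z (g n k) \<omega> \<notin> A) \<and> Z (g n (?N n)) \<omega> = j}
       \<longleftrightarrow> \<omega> \<in> {\<omega> \<in> space (P i). (\<forall>s\<in>{0..u+v}. Z s \<omega> \<notin> A) \<and> Z (u + v) \<omega> = j}) sequentially"
    proof eventually_elim
      case (elim n)
      have "(\<forall>k\<le>?N n. Z (g n k) \<omega> \<notin> A) \<longleftrightarrow> (\<forall>s\<in>{0..u+v}. Z s \<omega> \<notin> A)"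
        unfolding split elim union[symmetric] by blast
      then show ?case unfolding g_end by simp
    qed
  qed
  moreover have "prob {\<omega> \<in> space (P i). (\<forall>k\<le>?N n. Z (g n k) \<omega> \<notin> A) \<and> Z (g n (?N n)) \<omega> = j}
    = (\<Sum>x\<in>UNIV. killed_grid q A (\<lambda>k. real k * u / Suc n) (Suc n) i x * killed_grid q A (\<lambda>k. real k * v / Suc n) (Suc n) x j)"
    (is "?lhs n = ?rhs n") for n
  proof -
    have "?lhs n = killed_grid q A (g n) (?N n) i j"
      by (rule prob_grid) (use g0 g_mono in auto)
    also have "\<dots> = (\<Sum>x\<in>UNIV. killed_grid q A (g n) (Suc n) i x * killed_grid q A (\<lambda>k. g n (Suc n + k)) (Suc n) x j)"
      by (rule killed_grid_add)
    also have "\<dots> = ?rhs n"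
      by (intro sum.cong refl arg_cong2[where f = "(*)"] killed_grid_cong g_diff_first g_diff_second)
    finally show ?thesis .
  qed
  moreover have "?rhs \<longlonglongrightarrow> (\<Sum>x\<in>UNIV. killed_prob u i x * killed_prob v x j)"
    by (intro tendsto_sum tendsto_mult killed_grid_tendsto u v)
  ultimately show ?thesis
    by (simp only: LIMSEQ_unique)
qed

section \<open>Short-time comparison with the unkilled chain\<close>

text \<open>Read off from the chain, since the signs are not visible in the exponential
  series.\<close>

lemma transition_prob_nonneg: "0 \<le> t \<Longrightarrow> 0 \<le> transition_prob q t i j"
  using ctmc.prob_state[OF chain, of t i j] by (metis measure_nonneg)

lemma sum_transition_prob:
  assumes "0 \<le> t"
  shows "(\<Sum>j\<in>UNIV. transition_prob q t i j) = 1"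
proof -
  interpret ctmc "P i" q Z i by (rule chain)
  have "prob {\<omega> \<in> space (P i). True} = (\<Sum>x\<in>UNIV. prob {\<omega> \<in> space (P i). True \<and> Z t \<omega> = x})"
    by (rule prob_partition_state[OF assms]) simp
  then show ?thesis using prob_state[OF assms] by (simp add: prob_space)
qed

text \<open>Chapman-Kolmogorov through the chain instead of a product of exponential series:
  \<open>prob_grid\<close> with an empty killing set on the grid \<open>0, s, s + t\<close>.\<close>

lemma transition_prob_add:
  assumes "0 \<le> s" "0 \<le> t"
  shows "transition_prob q (s + t) i j = (\<Sum>x\<in>UNIV. transition_prob q s i x * transition_prob q t x j)"
proof -
  interpret ctmc "P i" q Z i by (rule chain)
  define g where "g k = (if k = 0 then 0 else if k = 1 then s else s + t)" for k :: nat
  have "prob {\<omega> \<in> space (P i). (\<forall>k\<le>Suc (Suc 0). Z (g k) \<omega> \<notin> {}) \<and> Z (g (Suc (Suc 0))) \<omega> = j}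
     = killed_grid q {} g (Suc (Suc 0)) i j"
    by (rule prob_grid) (use assms in \<open>auto simp: g_def\<close>)
  also have "\<dots> = (\<Sum>x\<in>UNIV. transition_prob q s i x * transition_prob q t x j)"
    by (simp add: g_def)
  finally show ?thesis using prob_state[of "s + t" j] assms by (simp add: g_def)
qed

lemma killed_grid_le_transition_prob:
  assumes "0 \<le> s"
  shows "killed_grid q A (\<lambda>k. real k * s) n i j \<le> transition_prob q (real n * s) i j"
proof -
  interpret ctmc "P i" q Z i by (rule chain)
  have "killed_grid q A (\<lambda>k. real k * s) n i j
    = prob {\<omega> \<in> space (P i). (\<forall>k\<le>n. Z (real k * s) \<omega> \<notin> A) \<and> Z (real n * s) \<omega> = j}"
    by (rule prob_grid[symmetric]) (use assms in \<open>auto intro: mult_right_mono\<close>)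
  also have "\<dots> \<le> prob {\<omega> \<in> space (P i). Z (real n * s) \<omega> = j}"
  proof (rule finite_measure_mono)
    have [measurable]: "Z (real n * s) \<in> measurable (P i) (count_space UNIV)"
      using measurable_state assms by auto
    show "{\<omega> \<in> space (P i). Z (real n * s) \<omega> = j} \<in> sets (P i)" by measurable
  qed auto
  also have "\<dots> = transition_prob q (real n * s) i j"
    using assms by (intro prob_state) auto
  finally show ?thesis .
qed

text \<open>A path from \<open>i \<notin> A\<close> that hits \<open>A\<close> and is outside \<open>A\<close> at the end makes at least two jumps, which has
  probability of second order in the elapsed time.\<close>

lemma killed_grid_error:
  assumes c: "0 \<le> c" and rate: "\<And>x y r. x \<noteq> y \<Longrightarrow> 0 \<le> r \<Longrightarrow> r \<le> t0 \<Longrightarrow> transition_prob q r x y \<le> c * r"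
    and i: "i \<notin> A" and s: "0 \<le> s" and "real n * s \<le> t0"
  shows "(\<Sum>j\<in>-A. transition_prob q (real n * s) i j - killed_grid q A (\<lambda>k. real k * s) n i j)
     \<le> (c * CARD('s) * (real n * s))\<^sup>2"
  using assms(5)
proof (induction n)
  case 0
  then show ?case using i by (intro order_trans[OF sum_nonpos]) (auto simp: transition_prob_zero)
next
  case (Suc n)
  let ?K = "killed_grid q A (\<lambda>k. real k * s)" and ?N = "real CARD('s)"
  have ns: "real n * s \<le> t0" "s \<le> t0" "0 \<le> real n * s"
    using Suc.prems s by (auto simp: algebra_simps) (smt (verit) mult_nonneg_nonneg of_nat_0_le_iff)
  \<comment> \<open>The mass at \<open>x\<close> of the paths that have met \<open>A\<close> at one
    of the grid times so far.\<close>
  define d where "d x = transition_prob q (real n * s) i x - ?K n i x" for x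
  have d: "0 \<le> d x" for x
    unfolding d_def using killed_grid_le_transition_prob[OF s] by (simp add: diff_ge_0_iff_ge)
  have dA: "d x \<le> c * (real n * s)" if "x \<in> A" for x
    using rate[of i x "real n * s"] ns i that by (auto simp: d_def killed_grid_eq_0)
  have row: "(\<Sum>j\<in>-A. transition_prob q s x j) \<le> 1" for x
    using sum_mono2[of UNIV "-A" "transition_prob q s x"] sum_transition_prob[OF s, of x] transition_prob_nonneg[OF s]
    by simp
  have rowA: "(\<Sum>j\<in>-A. transition_prob q s x j) \<le> ?N * (c * s)" if "x \<in> A" for x
  proof -
    have "(\<Sum>j\<in>-A. transition_prob q s x j) \<le> (\<Sum>j\<in>-A. c * s)"
      using that s ns by (intro sum_mono rate) auto
    also have "\<dots> = card (-A) * (c * s)" by simp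
    also have "\<dots> \<le> ?N * (c * s)"
      using c s by (intro mult_right_mono) (auto intro: card_mono)
    finally show ?thesis .
  qed
  have "transition_prob q (real (Suc n) * s) i j - ?K (Suc n) i j = (\<Sum>x\<in>UNIV. d x * transition_prob q s x j)"
    if "j \<in> -A" for j
  proof -
    have "real (Suc n) * s = real n * s + s" by (simp add: algebra_simps)
    then have "transition_prob q (real (Suc n) * s) i j = (\<Sum>x\<in>UNIV. transition_prob q (real n * s) i x * transition_prob q s x j)"
      using transition_prob_add[OF ns(3) s] by simp
    moreover have "real (Suc n) * s - real n * s = s" by (simp add: algebra_simps)
    ultimately show ?thesis
      using that by (simp add: d_def sum_subtractf left_diff_distrib)
  qed
  then have "(\<Sum>j\<in>-A. transition_prob q (real (Suc n) * s) i j - ?K (Suc n) i j)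
    = (\<Sum>j\<in>-A. \<Sum>x\<in>UNIV. d x * transition_prob q s x j)"
    by (intro sum.cong) auto
  also have "\<dots> = (\<Sum>x\<in>UNIV. d x * (\<Sum>j\<in>-A. transition_prob q s x j))"
    by (subst sum.swap) (simp add: sum_distrib_left)
  \<comment> \<open>Off \<open>A\<close>, mass that is already in error moves on with row sum at
    most 1. In \<open>A\<close>, the mass itself is \<open>O(n * s)\<close>, and leaving in the next
    step costs another factor \<open>O(s)\<close>.\<close>
  also have "\<dots> = (\<Sum>x\<in>-A. d x * (\<Sum>j\<in>-A. transition_prob q s x j)) + (\<Sum>x\<in>A. d x * (\<Sum>j\<in>-A. transition_prob q s x j))"
    by (subst sum.union_disjoint[symmetric]) (auto simp: Un_commute)
  also have "\<dots> \<le> (\<Sum>x\<in>-A. d x * 1) + (\<Sum>x\<in>A. (c * (real n * s)) * (?N * (c * s)))"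
    using d dA row rowA c s
    by (intro add_mono sum_mono mult_mono mult_left_mono sum_nonneg transition_prob_nonneg) auto
  also have "\<dots> \<le> (c * ?N * (real n * s))\<^sup>2 + ?N * ((c * (real n * s)) * (?N * (c * s)))"
  proof (intro add_mono)
    show "(\<Sum>x\<in>-A. d x * 1) \<le> (c * ?N * (real n * s))\<^sup>2"
      using Suc.IH[OF ns(1)] by (simp add: d_def)
    have "(\<Sum>x\<in>A. (c * (real n * s)) * (?N * (c * s))) = card A * ((c * (real n * s)) * (?N * (c * s)))"
      by simp
    also have "\<dots> \<le> ?N * ((c * (real n * s)) * (?N * (c * s)))"
      using c s by (intro mult_right_mono mult_nonneg_nonneg) (auto intro: card_mono)
    finally show "(\<Sum>x\<in>A. (c * (real n * s)) * (?N * (c * s))) \<le> ?N * ((c * (real n * s)) * (?N * (c * s)))" .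
  qed
  also have "\<dots> = (c * ?N * s)\<^sup>2 * (real n ^ 2 + real n)"
    by (simp add: power2_eq_square algebra_simps)
  \<comment> \<open>\<open>n^2 + n <= (n + 1)^2\<close> absorbs the new term. This closes the
    induction with a bound in the elapsed time alone, whatever the number of steps.\<close>
  also have "\<dots> \<le> (c * ?N * s)\<^sup>2 * (real (Suc n))\<^sup>2"
    by (intro mult_left_mono zero_le_power2) (simp add: power2_eq_square algebra_simps)
  also have "\<dots> = (c * ?N * (real (Suc n) * s))\<^sup>2"
    by (simp only: power_mult_distrib mult_ac)
  finally show ?case .
qed

lemma killed_prob_nonneg: "0 \<le> killed_prob t i j"
  by (simp add: killed_prob_def)

lemma killed_prob_le_transition_prob:
  assumes "0 \<le> t"
  shows "killed_prob t i j \<le> transition_prob q t i j"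
proof (rule LIMSEQ_le_const2[OF killed_grid_tendsto[OF assms]])
  have "killed_grid q A (\<lambda>k. real k * t / Suc n) (Suc n) i j \<le> transition_prob q t i j" for n
    using killed_grid_le_transition_prob[of "t / Suc n" "Suc n" i j] assms by (simp del: killed_grid.simps of_nat_Suc)
  then show "\<exists>N. \<forall>n\<ge>N. killed_grid q A (\<lambda>k. real k * t / Suc n) (Suc n) i j \<le> transition_prob q t i j"
    by blast
qed

text \<open>The grid bound depends only on the total time \<open>t\<close> and so passes to the
  limit; the summands are nonnegative, so each one obeys the bound on the sum.\<close>

lemma killed_prob_error:
  assumes c: "0 \<le> c" and rate: "\<And>x y r. x \<noteq> y \<Longrightarrow> 0 \<le> r \<Longrightarrow> r \<le> t0 \<Longrightarrow> transition_prob q r x y \<le> c * r"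
    and "i \<notin> A" "j \<notin> A" and t: "0 \<le> t" "t \<le> t0"
  shows "transition_prob q t i j - killed_prob t i j \<le> (c * CARD('s) * t)\<^sup>2"
proof -
  have "(\<Sum>x\<in>-A. transition_prob q t i x - killed_prob t i x) \<le> (c * CARD('s) * t)\<^sup>2"
  proof (rule LIMSEQ_le_const2)
    show "(\<lambda>n. \<Sum>x\<in>-A. transition_prob q t i x - killed_grid q A (\<lambda>k. real k * t / Suc n) (Suc n) i x)
      \<longlonglongrightarrow> (\<Sum>x\<in>-A. transition_prob q t i x - killed_prob t i x)"
      by (intro tendsto_sum tendsto_diff tendsto_const killed_grid_tendsto t)
    have "(\<Sum>x\<in>-A. transition_prob q t i x - killed_grid q A (\<lambda>k. real k * t / Suc n) (Suc n) i x) \<le> (c * CARD('s) * t)\<^sup>2" for n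
      using killed_grid_error[OF c rate \<open>i \<notin> A\<close>, of t0 "t / Suc n" "Suc n"] t
      by (simp del: killed_grid.simps of_nat_Suc)
    then show "\<exists>N. \<forall>n\<ge>N. (\<Sum>x\<in>-A. transition_prob q t i x - killed_grid q A (\<lambda>k. real k * t / Suc n) (Suc n) i x) \<le> (c * CARD('s) * t)\<^sup>2"
      by blast
  qed
  moreover have "transition_prob q t i j - killed_prob t i j \<le> (\<Sum>x\<in>-A. transition_prob q t i x - killed_prob t i x)"
    using killed_prob_le_transition_prob[OF t(1)] \<open>j \<notin> A\<close> by (intro member_le_sum) auto
  ultimately show ?thesis by linarith
qed

text \<open>Off the diagonal the difference quotients at 0 tend to entries of the generator, all
  below \<open>c\<close>; finitely many pairs of states allow a common \<open>t0\<close>.\<close>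

lemma transition_prob_le_linear:
  obtains c t0 where "0 \<le> c" "0 < t0" "\<And>x y r. x \<noteq> y \<Longrightarrow> 0 \<le> r \<Longrightarrow> r \<le> t0 \<Longrightarrow> transition_prob q r x y \<le> c * r"
proof -
  \<comment> \<open>The added 1 makes \<open>c\<close> strictly larger than every entry, as the
    passage from a limit to an eventual bound requires.\<close>
  define c where "c = (\<Sum>x\<in>UNIV. \<Sum>y\<in>UNIV. \<bar>generator q $ x $ y\<bar>) + 1"
  have c: "generator q $ x $ y < c" for x y
  proof -
    have "\<bar>generator q $ x $ y\<bar> \<le> (\<Sum>y\<in>UNIV. \<bar>generator q $ x $ y\<bar>)"
      by (intro member_le_sum) auto
    also have "\<dots> \<le> (\<Sum>x\<in>UNIV. \<Sum>y\<in>UNIV. \<bar>generator q $ x $ y\<bar>)"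
      by (intro member_le_sum[where f = "\<lambda>x. \<Sum>y\<in>UNIV. \<bar>generator q $ x $ y\<bar>"] sum_nonneg) auto
    finally show ?thesis unfolding c_def by linarith
  qed
  have "eventually (\<lambda>r. x \<noteq> y \<longrightarrow> transition_prob q r x y \<le> c * r) (at_right 0)" for x y
  proof -
    have "((\<lambda>r. (transition_prob q r x y - transition_prob q 0 x y) / r) \<longlongrightarrow> generator q $ x $ y) (at 0)"
      using transition_prob_has_derivative_zero[of q x y] by (simp add: has_field_derivative_iff)
    then have "((\<lambda>r. (transition_prob q r x y - transition_prob q 0 x y) / r) \<longlongrightarrow> generator q $ x $ y) (at_right 0)"
      by (rule tendsto_mono[rotated]) (simp add: at_le)
    from order_tendstoD(2)[OF this c] eventually_at_right_less
    show ?thesis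
      by eventually_elim (auto simp: transition_prob_zero field_simps)
  qed
  then have "eventually (\<lambda>r. \<forall>x y. x \<noteq> y \<longrightarrow> transition_prob q r x y \<le> c * r) (at_right 0)"
    by (intro eventually_all_finite)
  then obtain b where b: "0 < b" "\<And>r x y. 0 < r \<Longrightarrow> r < b \<Longrightarrow> x \<noteq> y \<Longrightarrow> transition_prob q r x y \<le> c * r"
    unfolding eventually_at_right_field by auto
  show ?thesis
  proof (rule that)
    show "0 \<le> c" unfolding c_def by (intro add_nonneg_nonneg sum_nonneg) auto
    \<comment> \<open>The bound holds for \<open>r\<close> strictly below \<open>b\<close>; halving
      gives a closed range \<open>r <= t0\<close>.\<close>
    show "0 < b / 2" using b by simp
    show "transition_prob q r x y \<le> c * r" if "x \<noteq> y" "0 \<le> r" "r \<le> b / 2" for x y r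
      using b that by (cases "r = 0") (auto simp: transition_prob_zero)
  qed
qed

text \<open>Sandwich: killing only lowers the transition probability, and by at most a constant
  times \<open>t^2\<close>, which vanishes after division by \<open>t\<close>.\<close>

lemma killed_prob_deriv:
  assumes "i \<notin> A" "j \<notin> A"
  shows "((\<lambda>t. (killed_prob t i j - of_bool (i = j)) / t) \<longlongrightarrow> generator q $ i $ j) (at_right 0)"
proof -
  obtain c t0 where ct: "0 \<le> c" "0 < t0"
    "\<And>x y r. x \<noteq> y \<Longrightarrow> 0 \<le> r \<Longrightarrow> r \<le> t0 \<Longrightarrow> transition_prob q r x y \<le> c * r"
    using transition_prob_le_linear by blast
  let ?f = "\<lambda>t. (transition_prob q t i j - of_bool (i = j)) / t"
  let ?c = "(c * CARD('s))\<^sup>2"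
  have "(?f \<longlongrightarrow> generator q $ i $ j) (at 0)"
    using transition_prob_has_derivative_zero[of q i j] by (simp add: has_field_derivative_iff transition_prob_zero)
  then have f: "(?f \<longlongrightarrow> generator q $ i $ j) (at_right 0)"
    by (rule tendsto_mono[rotated]) (simp add: at_le)
  have "((\<lambda>t. ?f t - ?c * t) \<longlongrightarrow> generator q $ i $ j - ?c * 0) (at_right 0)"
    by (intro tendsto_diff tendsto_mult tendsto_const f tendsto_ident_at)
  then have g: "((\<lambda>t. ?f t - ?c * t) \<longlongrightarrow> generator q $ i $ j) (at_right 0)" by simp
  have small: "eventually (\<lambda>t. 0 < t \<and> t < t0) (at_right 0)"
    using ct(2) by (auto simp: eventually_at_right_field)
  show ?thesis
  proof (rule tendsto_sandwich[OF _ _ g f])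
    show "eventually (\<lambda>t. (killed_prob t i j - of_bool (i = j)) / t \<le> ?f t) (at_right 0)"
      using small by eventually_elim (auto intro!: divide_right_mono killed_prob_le_transition_prob)
    show "eventually (\<lambda>t. ?f t - ?c * t \<le> (killed_prob t i j - of_bool (i = j)) / t) (at_right 0)"
      using small
    proof eventually_elim
      case (elim t)
      have "transition_prob q t i j - killed_prob t i j \<le> ?c * t * t"
        using killed_prob_error[OF ct(1,3) assms, of t0 t] elim by (simp add: power2_eq_square mult_ac)
      then have "(transition_prob q t i j - killed_prob t i j) / t \<le> ?c * t"
        using elim by (simp add: pos_divide_le_eq)
      then show ?case by (simp add: diff_divide_distrib)
    qed
  qed
qed

end

section \<open>Measurability and Tonelli\<close>

context ctmc
begin

text \<open>Joint measurability from right-continuity: evaluate the path at a time slightly to the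
  right that takes only countably many values, then refine. \<open>max 0\<close> keeps away from
  negative times, where the process is unspecified. Real-valued indicators of single states carry
  the limit argument.\<close>

lemma measurable_pair_state:
  "(\<lambda>(t, \<omega>). Z (max 0 t) \<omega>) \<in> measurable (borel \<Otimes>\<^sub>M M) (count_space UNIV)"
proof -
  let ?M = "(borel :: real measure) \<Otimes>\<^sub>M M"
  \<comment> \<open>For \<open>t >= 0\<close>, the first multiple of \<open>1 / Suc n\<close>
    strictly above \<open>t\<close>; for negative \<open>t\<close> the value is 0.\<close>
  define r where "r n t = max 0 ((real_of_int \<lfloor>t * Suc n\<rfloor> + 1) / Suc n)" for n and t :: real
  have ind: "(\<lambda>p. indicator {x} (Z (max 0 (fst p)) (snd p)) :: real) \<in> borel_measurable ?M" for x
  proof (rule borel_measurable_LIMSEQ_real)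
    fix p assume "p \<in> space ?M"
    then have w: "snd p \<in> space M" by (auto simp: space_pair_measure)
    define t where "t = fst p"
    have "eventually (\<lambda>n. Z (r n t) (snd p) = Z (max 0 t) (snd p)) sequentially"
    proof (cases "t < 0")
      case True
      have "r n t = 0" for n
      proof -
        have "t * Suc n < 0" using True by (intro mult_neg_pos) auto
        then have "\<lfloor>t * Suc n\<rfloor> < 0" by (simp only: floor_less_zero)
        then have "real_of_int \<lfloor>t * Suc n\<rfloor> + 1 \<le> 0" by linarith
        then show ?thesis unfolding r_def by (intro max_absorb1 divide_nonpos_pos) auto
      qed
      then show ?thesis using True by simp
    next
      case False
      then have t: "0 \<le> t" by simp
      obtain d where d: "t < d" "\<And>y. t < y \<Longrightarrow> y < d \<Longrightarrow> Z y (snd p) = Z t (snd p)"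
        using right_continuous[OF w t] unfolding eventually_at_right_field by auto
      have "eventually (\<lambda>n. inverse (real (Suc n)) < d - t) sequentially"
        using order_tendstoD(2)[OF LIMSEQ_inverse_real_of_nat, of "d - t"] d by simp
      then show ?thesis
      proof eventually_elim
        case (elim n)
        have f: "t * Suc n < real_of_int \<lfloor>t * Suc n\<rfloor> + 1" "real_of_int \<lfloor>t * Suc n\<rfloor> + 1 \<le> t * Suc n + 1"
          by linarith+
        have "t < (real_of_int \<lfloor>t * Suc n\<rfloor> + 1) / Suc n"
          using f(1) by (subst pos_less_divide_eq) auto
        moreover have "(real_of_int \<lfloor>t * Suc n\<rfloor> + 1) / Suc n \<le> (t * Suc n + 1) / Suc n"
          using f(2) by (rule divide_right_mono) simp
        moreover have "(t * Suc n + 1) / Suc n = t + inverse (real (Suc n))"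
          by (simp add: divide_simps)
        ultimately have "t < r n t" "r n t < d" using t elim unfolding r_def by auto
        then show ?case using d(2) t by (simp add: max_def)
      qed
    qed
    then have "eventually (\<lambda>n. indicator {x} (Z (r n t) (snd p)) = (indicator {x} (Z (max 0 t) (snd p)) :: real)) sequentially"
      by eventually_elim simp
    then show "(\<lambda>n. indicator {x} (Z (r n (fst p)) (snd p)) :: real) \<longlonglongrightarrow> indicator {x} (Z (max 0 (fst p)) (snd p))"
      unfolding t_def by (rule tendsto_eventually)
  next
    fix n
    \<comment> \<open>With the value of the floor fixed, the time is deterministic; countably many
      such pieces are then glued.\<close>
    have "(\<lambda>p. Z (max 0 ((real_of_int k + 1) / Suc n)) (snd p)) \<in> measurable ?M (count_space UNIV)" for k
      by (rule measurable_compose[OF measurable_snd]) (rule measurable_state, simp)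
    then have "(\<lambda>p. Z (max 0 ((real_of_int \<lfloor>fst p * Suc n\<rfloor> + 1) / Suc n)) (snd p)) \<in> measurable ?M (count_space UNIV)"
      by (rule measurable_compose_countable) measurable
    then have [measurable]: "(\<lambda>p. Z (r n (fst p)) (snd p)) \<in> measurable ?M (count_space UNIV)"
      unfolding r_def .
    show "(\<lambda>p. indicator {x} (Z (r n (fst p)) (snd p)) :: real) \<in> borel_measurable ?M"
      by measurable
  qed
  have "(\<lambda>(t, \<omega>). Z (max 0 t) \<omega>) -` {x} \<inter> space ?M \<in> sets ?M" for x
  proof -
    have "(\<lambda>p. indicator {x} (Z (max 0 (fst p)) (snd p)) :: real) -` {1} \<inter> space ?M \<in> sets ?M"
      by (rule measurable_sets[OF ind]) simp
    also have "(\<lambda>p. indicator {x} (Z (max 0 (fst p)) (snd p)) :: real) -` {1} \<inter> space ?M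
      = (\<lambda>(t, \<omega>). Z (max 0 t) \<omega>) -` {x} \<inter> space ?M"
      by (auto simp: indicator_def split: if_splits)
    finally show ?thesis .
  qed
  then show ?thesis by (subst measurable_count_space_eq2) auto
qed

text \<open>Strictness comes from right-continuity: a path off \<open>A\<close> up to time
  \<open>t\<close> remains there until some \<open>d > t\<close>, so the infimum is at least
  \<open>d\<close>.\<close>

lemma less_hitting_time_iff:
  assumes w: "\<omega> \<in> space M" and t: "0 \<le> t"
  shows "ennreal t < hitting_time Z A \<omega> \<longleftrightarrow> (\<forall>s\<in>{0..t}. Z s \<omega> \<notin> A)"
proof
  assume L: "ennreal t < hitting_time Z A \<omega>"
  show "\<forall>s\<in>{0..t}. Z s \<omega> \<notin> A"
  proof (intro ballI notI)
    fix s assume s: "s \<in> {0..t}" "Z s \<omega> \<in> A"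
    then have "hitting_time Z A \<omega> \<le> ennreal s"
      unfolding hitting_time_def by (intro Inf_lower) auto
    also have "\<dots> \<le> ennreal t" using s by (intro ennreal_leI) auto
    finally show False using L by simp
  qed
next
  assume R: "\<forall>s\<in>{0..t}. Z s \<omega> \<notin> A"
  obtain d where d: "t < d" "\<And>y. t < y \<Longrightarrow> y < d \<Longrightarrow> Z y \<omega> = Z t \<omega>"
    using right_continuous[OF w t] unfolding eventually_at_right_field by auto
  have "ennreal d \<le> hitting_time Z A \<omega>"
    unfolding hitting_time_def
  proof (intro Inf_greatest, clarify)
    fix s :: real assume s: "0 \<le> s" "Z s \<omega> \<in> A"
    have "d \<le> s"
    proof (rule ccontr)
      assume "\<not> d \<le> s"
      then have "Z s \<omega> = Z t \<omega> \<or> s \<le> t" using d(2)[of s] by (cases "s \<le> t") auto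
      moreover have "Z t \<omega> \<notin> A" using R t by auto
      ultimately show False using R s by auto
    qed
    then show "ennreal d \<le> ennreal s" by (rule ennreal_leI)
  qed
  moreover have "ennreal t < ennreal d" using d t by (simp add: ennreal_less_iff)
  ultimately show "ennreal t < hitting_time Z A \<omega>" by simp
qed

lemma borel_measurable_hitting_time [measurable]: "hitting_time Z A \<in> borel_measurable M"
proof (rule borel_measurableI_greater)
  fix y :: ennreal
  show "{\<omega> \<in> space M. y < hitting_time Z A \<omega>} \<in> sets M"
  proof (cases y rule: ennreal_cases)
    case (real t)
    have "{\<omega> \<in> space M. y < hitting_time Z A \<omega>} = {\<omega> \<in> space M. \<forall>s\<in>{0..t}. Z s \<omega> \<notin> A}"
      using less_hitting_time_iff[OF _ real(1)] real(2) by blast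
    then show ?thesis using sets_no_hit[of 0 t A] real by simp
  qed auto
qed

lemma pred_before_hitting:
  "Measurable.pred (lborel \<Otimes>\<^sub>M M) (\<lambda>(t, \<omega>). 0 \<le> t \<and> ennreal t < hitting_time Z A \<omega> \<and> R (Z t \<omega>))"
proof -
  have [measurable]: "(\<lambda>(t, \<omega>). Z (max 0 t) \<omega>) \<in> measurable (lborel \<Otimes>\<^sub>M M) (count_space UNIV)"
    using measurable_pair_state by (simp cong: measurable_cong_sets sets_pair_measure_cong)
  \<comment> \<open>Under the guard \<open>0 <= t\<close> the clipped time equals \<open>t\<close>,
    so joint measurability is available.\<close>
  have "Measurable.pred (lborel \<Otimes>\<^sub>M M) (\<lambda>p. 0 \<le> fst p \<and> ennreal (fst p) < hitting_time Z A (snd p)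
      \<and> R ((\<lambda>(t, \<omega>). Z (max 0 t) \<omega>) p))"
    by measurable
  also have "(\<lambda>p. 0 \<le> fst p \<and> ennreal (fst p) < hitting_time Z A (snd p)
      \<and> R ((\<lambda>(t, \<omega>). Z (max 0 t) \<omega>) p)) = (\<lambda>(t, \<omega>). 0 \<le> t \<and> ennreal t < hitting_time Z A \<omega> \<and> R (Z t \<omega>))"
    by (auto simp: max_def fun_eq_iff)
  finally show ?thesis .
qed

lemma nn_integral_before_hitting_swap:
  "(\<integral>\<^sup>+\<omega>. (\<integral>\<^sup>+t. of_bool (0 \<le> t \<and> ennreal t < hitting_time Z A \<omega> \<and> R (Z t \<omega>)) \<partial>lborel) \<partial>M)
    = (\<integral>\<^sup>+t. (\<integral>\<^sup>+\<omega>. of_bool (0 \<le> t \<and> ennreal t < hitting_time Z A \<omega> \<and> R (Z t \<omega>)) \<partial>M) \<partial>lborel)"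
proof -
  interpret pair_sigma_finite lborel M ..
  have "(\<lambda>p. of_bool ((\<lambda>(t, \<omega>). 0 \<le> t \<and> ennreal t < hitting_time Z A \<omega> \<and> R (Z t \<omega>)) p) :: ennreal)
     \<in> borel_measurable (lborel \<Otimes>\<^sub>M M)"
    using pred_before_hitting by measurable
  from Fubini[OF this] show ?thesis by simp
qed

end

text \<open>Layer-cake form of the hitting time, infinite values included, ready for
  Tonelli.\<close>

lemma nn_integral_of_bool_before:
  "(\<integral>\<^sup>+t. of_bool (0 \<le> t \<and> ennreal t < x) \<partial>lborel) = x"
proof (cases x rule: ennreal_cases)
  case (real r)
  have "(\<integral>\<^sup>+t. of_bool (0 \<le> t \<and> ennreal t < x) \<partial>lborel) = (\<integral>\<^sup>+t. indicator {0..<r} t \<partial>lborel)"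
    using real by (intro nn_integral_cong) (auto simp: ennreal_less_iff indicator_def)
  then show ?thesis using real by simp
next
  case top
  have "(\<integral>\<^sup>+t. of_bool (0 \<le> t \<and> ennreal t < x) \<partial>lborel) = (\<integral>\<^sup>+t. indicator {0::real..} t \<partial>lborel)"
    using top by (intro nn_integral_cong) (auto simp: indicator_def)
  also have "\<dots> = emeasure lborel {0::real..}" by simp
  also have "\<dots> = \<infinity>"
  proof -
    have "of_nat n \<le> emeasure lborel {0::real..}" for n
      using emeasure_mono[of "{0..real n}" "{0..}" lborel] by (simp add: ennreal_of_nat_eq_real_of_nat)
    then show ?thesis by (metis ennreal_SUP_of_nat_eq_top SUP_least infinity_ennreal_def top_unique)
  qed
  finally show ?thesis using top by simp
qed

text \<open>\<open>T^2 / 2\<close> as the area of a triangle: the second moment becomes a double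
  integral of the probability that \<open>u + v < T\<close>, to which the semigroup property
  applies.\<close>

lemma nn_integral_triangle:
  assumes "0 \<le> (T::real)"
  shows "(\<integral>\<^sup>+u. (\<integral>\<^sup>+v. of_bool (0 \<le> u \<and> 0 \<le> v \<and> u + v < T) \<partial>lborel) \<partial>lborel) = ennreal (T\<^sup>2 / 2)"
proof -
  have "(\<integral>\<^sup>+v. of_bool (0 \<le> u \<and> 0 \<le> v \<and> u + v < T) \<partial>lborel) = ennreal (T - u) * indicator {0..T} u" for u
  proof (cases "u \<in> {0..T}")
    case True
    have "(\<integral>\<^sup>+v. of_bool (0 \<le> u \<and> 0 \<le> v \<and> u + v < T) \<partial>lborel) = (\<integral>\<^sup>+v. indicator {0..<T - u} v \<partial>lborel)"
      using True by (intro nn_integral_cong) (auto simp: indicator_def)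
    then show ?thesis using True by simp
  next
    case False
    then have "(\<lambda>v. of_bool (0 \<le> u \<and> 0 \<le> v \<and> u + v < T) :: ennreal) = (\<lambda>_. 0)"
      by (auto simp: fun_eq_iff)
    then show ?thesis using False by (simp only: nn_integral_const) simp
  qed
  moreover have "(\<integral>\<^sup>+u. ennreal (T - u) * indicator {0..T} u \<partial>lborel) = ennreal ((T * T - T\<^sup>2 / 2) - (T * 0 - 0\<^sup>2 / 2))"
    by (rule nn_integral_FTC_Icc[where F = "\<lambda>u. T * u - u\<^sup>2 / 2"])
       (use assms in \<open>auto intro!: derivative_eq_intros\<close>)
  ultimately show ?thesis by (simp add: power2_eq_square)
qed

section \<open>Moments of the hitting time\<close>

context ctmc_family
begin

text \<open>Extended by 0 to negative times so that integrals run over the whole line, and valued in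
  \<open>ennreal\<close> so that they exist before finiteness is known.\<close>

definition occupation_density :: "'s \<Rightarrow> 's \<Rightarrow> real \<Rightarrow> ennreal" where
  "occupation_density i j t = ennreal (killed_prob t i j) * indicator {0..} t"

text \<open>An infinite integral would be sent to 0; \<open>nn_integral_occupation_density\<close>
  excludes this under finite means.\<close>

definition green :: "'s \<Rightarrow> 's \<Rightarrow> real" where
  "green i j = enn2real (\<integral>\<^sup>+t. occupation_density i j t \<partial>lborel)"

lemma occupation_density_eq:
  "occupation_density i j t = (\<integral>\<^sup>+\<omega>. of_bool (0 \<le> t \<and> ennreal t < hitting_time Z A \<omega> \<and> Z t \<omega> = j) \<partial>P i)"
proof (cases "0 \<le> t")
  case True
  interpret ctmc "P i" q Z i by (rule chain)
  let ?E = "{\<omega> \<in> space (P i). (\<forall>s\<in>{0..t}. Z s \<omega> \<notin> A) \<and> Z t \<omega> = j}"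
  have "(\<integral>\<^sup>+\<omega>. of_bool (0 \<le> t \<and> ennreal t < hitting_time Z A \<omega> \<and> Z t \<omega> = j) \<partial>P i) = (\<integral>\<^sup>+\<omega>. indicator ?E \<omega> \<partial>P i)"
    using True by (intro nn_integral_cong) (simp add: less_hitting_time_iff indicator_def)
  also have "\<dots> = emeasure (P i) ?E"
    using sets_no_hit_state[OF True] by (rule nn_integral_indicator)
  also have "\<dots> = ennreal (killed_prob t i j)"
    unfolding killed_prob_def by (rule emeasure_eq_measure)
  finally show ?thesis using True by (simp add: occupation_density_def)
next
  case False
  then show ?thesis by (simp add: occupation_density_def)
qed

text \<open>The density is a partial integral of a jointly measurable function, which gives
  measurability in \<open>t\<close>.\<close>

lemma borel_measurable_occupation_density [measurable]: "occupation_density i j \<in> borel_measurable borel"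
proof -
  interpret ctmc "P i" q Z i by (rule chain)
  have "(\<lambda>p. of_bool ((\<lambda>(t, \<omega>). 0 \<le> t \<and> ennreal t < hitting_time Z A \<omega> \<and> Z t \<omega> = j) p) :: ennreal)
     \<in> borel_measurable (lborel \<Otimes>\<^sub>M P i)"
    using pred_before_hitting[of A "\<lambda>x. x = j"] by measurable
  from borel_measurable_nn_integral_fst[OF this] show ?thesis
    by (simp add: occupation_density_eq[abs_def])
qed

text \<open>The predicate \<open>R\<close> serves two purposes: the constant \<open>True\<close>
  gives the mean hitting time, a set of states gives the expected time spent there before the
  hit.\<close>

lemma nn_integral_before_hitting:
  "(\<integral>\<^sup>+\<omega>. (\<integral>\<^sup>+t. of_bool (0 \<le> t \<and> ennreal t < hitting_time Z A \<omega> \<and> R (Z t \<omega>)) \<partial>lborel) \<partial>P i)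
    = (\<Sum>j | R j. \<integral>\<^sup>+t. occupation_density i j t \<partial>lborel)"
proof -
  interpret ctmc "P i" q Z i by (rule chain)
  have *: "(\<integral>\<^sup>+\<omega>. of_bool (0 \<le> t \<and> ennreal t < hitting_time Z A \<omega> \<and> R (Z t \<omega>)) \<partial>P i)
    = (\<Sum>j | R j. occupation_density i j t)" for t
  proof (cases "0 \<le> t")
    case True
    then have [measurable]: "Z t \<in> measurable (P i) (count_space UNIV)" by (rule measurable_state)
    have "of_bool (0 \<le> t \<and> ennreal t < hitting_time Z A \<omega> \<and> R (Z t \<omega>))
      = (\<Sum>j | R j. of_bool (0 \<le> t \<and> ennreal t < hitting_time Z A \<omega> \<and> Z t \<omega> = j) :: ennreal)" for \<omega>
    proof -
      have "(\<Sum>j | R j. of_bool (0 \<le> t \<and> ennreal t < hitting_time Z A \<omega> \<and> Z t \<omega> = j) :: ennreal)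
        = (\<Sum>j | R j. if Z t \<omega> = j then of_bool (0 \<le> t \<and> ennreal t < hitting_time Z A \<omega>) else 0)"
        by (intro sum.cong) auto
      then show ?thesis by simp
    qed
    then have "(\<integral>\<^sup>+\<omega>. of_bool (0 \<le> t \<and> ennreal t < hitting_time Z A \<omega> \<and> R (Z t \<omega>)) \<partial>P i)
      = (\<integral>\<^sup>+\<omega>. (\<Sum>j | R j. of_bool (0 \<le> t \<and> ennreal t < hitting_time Z A \<omega> \<and> Z t \<omega> = j)) \<partial>P i)"
      by (simp only:)
    also have "\<dots> = (\<Sum>j | R j. \<integral>\<^sup>+\<omega>. of_bool (0 \<le> t \<and> ennreal t < hitting_time Z A \<omega> \<and> Z t \<omega> = j) \<partial>P i)"
      by (rule nn_integral_sum) measurable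
    finally show ?thesis by (simp only: occupation_density_eq)
  next
    case False
    then show ?thesis by (simp add: occupation_density_def)
  qed
  show ?thesis
    unfolding nn_integral_before_hitting_swap * by (rule nn_integral_sum) measurable
qed

lemma nn_integral_hitting_time:
  "(\<integral>\<^sup>+\<omega>. hitting_time Z A \<omega> \<partial>P i) = (\<Sum>j\<in>UNIV. \<integral>\<^sup>+t. occupation_density i j t \<partial>lborel)"
  using nn_integral_before_hitting[where R = "\<lambda>_. True" and i = i] by (simp add: nn_integral_of_bool_before)

text \<open>For \<open>i \<in> A\<close> the event is null but possibly nonempty, since
  \<open>Z 0 = i\<close> holds only almost surely; along the grids the values are exactly 0.\<close>

lemma killed_prob_eq_0:
  assumes "0 \<le> t" "i \<in> A \<or> j \<in> A"
  shows "killed_prob t i j = 0"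
proof -
  have "killed_grid q A s n i j = 0" for s n
  proof (cases "j \<in> A")
    case False
    then have "i \<in> A" using assms by auto
    then show ?thesis by (induction n arbitrary: j) auto
  qed (rule killed_grid_eq_0)
  then have "(\<lambda>n. 0) \<longlonglongrightarrow> killed_prob t i j"
    using killed_grid_tendsto[OF assms(1), of i j] by (simp only:)
  then show ?thesis by (simp add: LIMSEQ_const_iff)
qed

lemma green_eq_0: "i \<in> A \<or> j \<in> A \<Longrightarrow> green i j = 0"
proof -
  assume "i \<in> A \<or> j \<in> A"
  then have "occupation_density i j = (\<lambda>_. 0)"
    by (auto simp: occupation_density_def fun_eq_iff indicator_def killed_prob_eq_0)
  then show ?thesis by (simp add: green_def)
qed

lemma green_nonneg: "0 \<le> green i j"
  by (simp add: green_def)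

lemma occupation_density_add:
  assumes "0 \<le> s" "0 \<le> t"
  shows "occupation_density i j (s + t) = (\<Sum>x\<in>UNIV. occupation_density i x s * occupation_density x j t)"
  using assms
  by (simp add: occupation_density_def killed_prob_add killed_prob_nonneg sum_ennreal[symmetric]
      ennreal_mult[symmetric] del: sum_ennreal)

end

locale finite_mean_hitting = ctmc_family P q Z A
  for P :: "'s::finite \<Rightarrow> 'w measure" and q :: "'s \<Rightarrow> 's \<Rightarrow> real"
    and Z :: "real \<Rightarrow> 'w \<Rightarrow> 's" and A :: "'s set" +
  assumes finite_mean: "\<And>S. (\<integral>\<^sup>+\<omega>. hitting_time Z A \<omega> \<partial>P S) < \<infinity>"
begin

text \<open>Each entry is dominated by its row sum, which is a mean hitting time and hence
  finite.\<close>

lemma nn_integral_occupation_density: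
  "(\<integral>\<^sup>+t. occupation_density i j t \<partial>lborel) = ennreal (green i j)"
proof -
  have "(\<integral>\<^sup>+t. occupation_density i j t \<partial>lborel) \<le> (\<Sum>j\<in>UNIV. \<integral>\<^sup>+t. occupation_density i j t \<partial>lborel)"
    by (rule member_le_sum) auto
  then have "(\<integral>\<^sup>+t. occupation_density i j t \<partial>lborel) < top"
    using finite_mean[of i] unfolding nn_integral_hitting_time by simp
  then show ?thesis by (simp add: green_def)
qed

lemma mean_hitting_time: "(\<integral>\<^sup>+\<omega>. hitting_time Z A \<omega> \<partial>P i) = ennreal (\<Sum>j\<in>UNIV. green i j)"
  unfolding nn_integral_hitting_time nn_integral_occupation_density by (simp add: green_nonneg)

lemma AE_hitting_time_finite: "AE \<omega> in P i. hitting_time Z A \<omega> < \<infinity>"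
proof -
  interpret ctmc "P i" q Z i by (rule chain)
  have "AE \<omega> in P i. hitting_time Z A \<omega> \<noteq> \<infinity>"
    using finite_mean[of i] by (intro nn_integral_PInf_AE) auto
  then show ?thesis by eventually_elim (simp add: less_top)
qed

lemma AE_ennreal_hitting_time: "AE \<omega> in P i. ennreal (enn2real (hitting_time Z A \<omega>)) = hitting_time Z A \<omega>"
  using AE_hitting_time_finite by eventually_elim simp

lemma expectation_hitting_time:
  "prob_space.expectation (P i) (\<lambda>\<omega>. enn2real (hitting_time Z A \<omega>)) = (\<Sum>j\<in>UNIV. green i j)"
proof -
  interpret ctmc "P i" q Z i by (rule chain)
  have "(\<integral>\<^sup>+\<omega>. ennreal (enn2real (hitting_time Z A \<omega>)) \<partial>P i) = (\<integral>\<^sup>+\<omega>. hitting_time Z A \<omega> \<partial>P i)"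
    by (intro nn_integral_cong_AE AE_ennreal_hitting_time)
  then show ?thesis
    by (subst integral_eq_nn_integral) (auto simp: mean_hitting_time green_nonneg sum_nonneg)
qed

text \<open>The Markov property at the deterministic time \<open>u\<close>: survive to some
  \<open>x\<close>, then survive for a further time \<open>v\<close> from \<open>x\<close>.\<close>

lemma nn_integral_survival_add:
  assumes "0 \<le> u" "0 \<le> v"
  shows "(\<integral>\<^sup>+\<omega>. of_bool (ennreal (u + v) < hitting_time Z A \<omega>) \<partial>P i)
    = (\<Sum>x\<in>UNIV. occupation_density i x u * (\<Sum>j\<in>UNIV. occupation_density x j v))"
proof -
  interpret ctmc "P i" q Z i by (rule chain)
  have uv: "0 \<le> u + v" using assms by simp
  then have [measurable]: "Z (u + v) \<in> measurable (P i) (count_space UNIV)" by (rule measurable_state)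
  have "(of_bool (ennreal (u + v) < hitting_time Z A \<omega>) :: ennreal)
      = (\<Sum>j\<in>UNIV. of_bool (0 \<le> u + v \<and> ennreal (u + v) < hitting_time Z A \<omega> \<and> Z (u + v) \<omega> = j))" for \<omega>
  proof -
    have "(\<Sum>j\<in>UNIV. of_bool (0 \<le> u + v \<and> ennreal (u + v) < hitting_time Z A \<omega> \<and> Z (u + v) \<omega> = j) :: ennreal)
      = (\<Sum>j\<in>UNIV. if Z (u + v) \<omega> = j then of_bool (ennreal (u + v) < hitting_time Z A \<omega>) else 0)"
      using uv by (intro sum.cong) auto
    then show ?thesis by simp
  qed
  then have "(\<integral>\<^sup>+\<omega>. of_bool (ennreal (u + v) < hitting_time Z A \<omega>) \<partial>P i)
    = (\<integral>\<^sup>+\<omega>. (\<Sum>j\<in>UNIV. of_bool (0 \<le> u + v \<and> ennreal (u + v) < hitting_time Z A \<omega> \<and> Z (u + v) \<omega> = j)) \<partial>P i)"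
    by (simp only:)
  also have "\<dots> = (\<Sum>j\<in>UNIV. \<integral>\<^sup>+\<omega>. of_bool (0 \<le> u + v \<and> ennreal (u + v) < hitting_time Z A \<omega> \<and> Z (u + v) \<omega> = j) \<partial>P i)"
    by (rule nn_integral_sum) measurable
  also have "\<dots> = (\<Sum>j\<in>UNIV. \<Sum>x\<in>UNIV. occupation_density i x u * occupation_density x j v)"
    by (simp only: occupation_density_eq[symmetric] occupation_density_add[OF assms])
  also have "\<dots> = (\<Sum>x\<in>UNIV. occupation_density i x u * (\<Sum>j\<in>UNIV. occupation_density x j v))"
    by (subst sum.swap) (simp only: sum_distrib_left)
  finally show ?thesis .
qed

text \<open>Two applications of Tonelli move the expectation inside the triangle integral. Of the
  factored survival probability, the integral over \<open>v\<close> yields the mean from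
  \<open>x\<close>, and the one over \<open>u\<close> yields \<open>green i x\<close>.\<close>

lemma nn_integral_hitting_time_sq:
  "(\<integral>\<^sup>+\<omega>. ennreal ((enn2real (hitting_time Z A \<omega>))\<^sup>2 / 2) \<partial>P i) = ennreal (\<Sum>x\<in>UNIV. green i x * (\<Sum>j\<in>UNIV. green x j))"
proof -
  interpret ctmc "P i" q Z i by (rule chain)
  interpret pair_sigma_finite lborel "P i" ..
  define f where "f u v \<omega> = (of_bool (0 \<le> u \<and> 0 \<le> v \<and> ennreal (u + v) < hitting_time Z A \<omega>) :: ennreal)" for u v \<omega>
  have [measurable]: "(\<lambda>p. f (fst (fst p)) (snd p) (snd (fst p))) \<in> borel_measurable ((lborel \<Otimes>\<^sub>M P i) \<Otimes>\<^sub>M lborel)"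
    unfolding f_def by measurable
  have m1: "(\<lambda>p. \<integral>\<^sup>+v. f (fst p) v (snd p) \<partial>lborel) \<in> borel_measurable (lborel \<Otimes>\<^sub>M P i)"
    by measurable
  have "(\<integral>\<^sup>+\<omega>. ennreal ((enn2real (hitting_time Z A \<omega>))\<^sup>2 / 2) \<partial>P i) = (\<integral>\<^sup>+\<omega>. (\<integral>\<^sup>+u. (\<integral>\<^sup>+v. f u v \<omega> \<partial>lborel) \<partial>lborel) \<partial>P i)"
  proof (rule nn_integral_cong_AE)
    show "AE \<omega> in P i. ennreal ((enn2real (hitting_time Z A \<omega>))\<^sup>2 / 2) = (\<integral>\<^sup>+u. (\<integral>\<^sup>+v. f u v \<omega> \<partial>lborel) \<partial>lborel)"
      using AE_ennreal_hitting_time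
    proof eventually_elim
      case (elim \<omega>)
      have "(0 \<le> u \<and> 0 \<le> v \<and> ennreal (u + v) < hitting_time Z A \<omega>)
        \<longleftrightarrow> (0 \<le> u \<and> 0 \<le> v \<and> u + v < enn2real (hitting_time Z A \<omega>))" for u v
        by (subst elim[symmetric]) (auto simp: ennreal_less_iff simp del: ennreal_plus)
      then show ?case
        unfolding f_def by (simp only: nn_integral_triangle[OF enn2real_nonneg])
    qed
  qed
  also have "\<dots> = (\<integral>\<^sup>+u. (\<integral>\<^sup>+\<omega>. (\<integral>\<^sup>+v. f u v \<omega> \<partial>lborel) \<partial>P i) \<partial>lborel)"
    using Fubini[OF m1] by simp
  also have "\<dots> = (\<integral>\<^sup>+u. (\<integral>\<^sup>+v. (\<integral>\<^sup>+\<omega>. f u v \<omega> \<partial>P i) \<partial>lborel) \<partial>lborel)"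
  proof (rule nn_integral_cong)
    fix u
    have "(\<lambda>p. f u (fst p) (snd p)) \<in> borel_measurable (lborel \<Otimes>\<^sub>M P i)"
      unfolding f_def by measurable
    from Fubini[OF this]
    show "(\<integral>\<^sup>+\<omega>. (\<integral>\<^sup>+v. f u v \<omega> \<partial>lborel) \<partial>P i) = (\<integral>\<^sup>+v. (\<integral>\<^sup>+\<omega>. f u v \<omega> \<partial>P i) \<partial>lborel)"
      by simp
  qed
  also have "\<dots> = (\<integral>\<^sup>+u. (\<integral>\<^sup>+v. (\<Sum>x\<in>UNIV. occupation_density i x u * (\<Sum>j\<in>UNIV. occupation_density x j v)) \<partial>lborel) \<partial>lborel)"
  proof (intro nn_integral_cong)
    fix u v :: real
    show "(\<integral>\<^sup>+\<omega>. f u v \<omega> \<partial>P i) = (\<Sum>x\<in>UNIV. occupation_density i x u * (\<Sum>j\<in>UNIV. occupation_density x j v))"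
    proof (cases "0 \<le> u \<and> 0 \<le> v")
      case True
      then show ?thesis using nn_integral_survival_add[of u v i] by (simp add: f_def)
    next
      \<comment> \<open>At a negative time both the indicator and one of the densities
        vanish.\<close>
      case False
      then show ?thesis by (auto simp: f_def occupation_density_def)
    qed
  qed
  also have "\<dots> = (\<integral>\<^sup>+u. (\<Sum>x\<in>UNIV. occupation_density i x u * ennreal (\<Sum>j\<in>UNIV. green x j)) \<partial>lborel)"
    by (intro nn_integral_cong)
       (simp add: nn_integral_sum nn_integral_cmult nn_integral_occupation_density green_nonneg)
  also have "\<dots> = (\<Sum>x\<in>UNIV. ennreal (green i x) * ennreal (\<Sum>j\<in>UNIV. green x j))"
    by (simp add: nn_integral_sum nn_integral_multc nn_integral_occupation_density)
  also have "\<dots> = ennreal (\<Sum>x\<in>UNIV. green i x * (\<Sum>j\<in>UNIV. green x j))"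
    by (simp add: ennreal_mult[symmetric] green_nonneg sum_nonneg)
  finally show ?thesis .
qed

lemma second_moment_hitting_time:
  shows "integrable (P i) (\<lambda>\<omega>. (enn2real (hitting_time Z A \<omega>))\<^sup>2)"
    and "prob_space.expectation (P i) (\<lambda>\<omega>. (enn2real (hitting_time Z A \<omega>))\<^sup>2)
      = 2 * (\<Sum>x\<in>UNIV. green i x * (\<Sum>j\<in>UNIV. green x j))"
proof -
  interpret ctmc "P i" q Z i by (rule chain)
  let ?f = "\<lambda>\<omega>. (enn2real (hitting_time Z A \<omega>))\<^sup>2 / 2"
  let ?c = "\<Sum>x\<in>UNIV. green i x * (\<Sum>j\<in>UNIV. green x j)"
  have "has_bochner_integral (P i) ?f ?c"
    by (rule has_bochner_integral_nn_integral)
       (auto simp: nn_integral_hitting_time_sq intro!: sum_nonneg mult_nonneg_nonneg green_nonneg)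
  then have "has_bochner_integral (P i) (\<lambda>\<omega>. 2 * ?f \<omega>) (2 * ?c)"
    by (intro has_bochner_integral_mult_right) auto
  then have "has_bochner_integral (P i) (\<lambda>\<omega>. (enn2real (hitting_time Z A \<omega>))\<^sup>2) (2 * ?c)"
    by simp
  then show "integrable (P i) (\<lambda>\<omega>. (enn2real (hitting_time Z A \<omega>))\<^sup>2)"
    "expectation (\<lambda>\<omega>. (enn2real (hitting_time Z A \<omega>))\<^sup>2) = 2 * ?c"
    by (auto simp: has_bochner_integral_iff)
qed

text \<open>Bridges the real integral over the closed interval \<open>[0, T]\<close> and the
  extended integral over times strictly before the hit. They can differ only at the null point
  \<open>t = T\<close> and on the null event that the hitting time is infinite.\<close>

lemma expectation_occupation_time:
  "prob_space.expectation (P i) (\<lambda>\<omega>. LINT u:{0..enn2real (hitting_time Z A \<omega>)}|lborel. of_bool (R (Z u \<omega>)))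
    = (\<Sum>j | R j. green i j)"
proof -
  interpret ctmc "P i" q Z i by (rule chain)
  define Y where "Y \<omega> = (\<integral>\<^sup>+t. of_bool (0 \<le> t \<and> ennreal t < hitting_time Z A \<omega> \<and> R (Z t \<omega>)) \<partial>lborel)" for \<omega>
  let ?X = "\<lambda>\<omega>. LINT u:{0..enn2real (hitting_time Z A \<omega>)}|lborel. of_bool (R (Z u \<omega>)) :: real"
  have meas: "(\<lambda>p. of_bool ((\<lambda>(t, \<omega>). 0 \<le> t \<and> ennreal t < hitting_time Z A \<omega> \<and> R (Z t \<omega>)) p) :: ennreal)
     \<in> borel_measurable (lborel \<Otimes>\<^sub>M P i)"
    using pred_before_hitting[of A R] by measurable
  interpret pair_sigma_finite lborel "P i" ..
  have Y_meas [measurable]: "Y \<in> borel_measurable (P i)"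
    unfolding Y_def using lborel.borel_measurable_nn_integral_fst[OF measurable_pair_swap[OF meas]] by simp
  have Y_finite: "Y \<omega> \<le> hitting_time Z A \<omega>" for \<omega>
  proof -
    have "Y \<omega> \<le> (\<integral>\<^sup>+t. of_bool (0 \<le> t \<and> ennreal t < hitting_time Z A \<omega>) \<partial>lborel)"
      unfolding Y_def by (intro nn_integral_mono) auto
    then show ?thesis by (simp add: nn_integral_of_bool_before)
  qed
  have X_eq: "?X \<omega> = (if hitting_time Z A \<omega> < \<infinity> then enn2real (Y \<omega>) else 0)" if w: "\<omega> \<in> space (P i)" for \<omega>
  proof (cases "hitting_time Z A \<omega> < \<infinity>")
    case True
    then obtain T where T: "hitting_time Z A \<omega> = ennreal T" "0 \<le> T"
      by (cases "hitting_time Z A \<omega>" rule: ennreal_cases) auto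
    have "(\<lambda>t. (t, \<omega>)) \<in> measurable lborel (lborel \<Otimes>\<^sub>M P i)" using w by measurable
    from measurable_compose[OF this meas]
    have m [measurable]: "(\<lambda>t. of_bool (0 \<le> t \<and> ennreal t < hitting_time Z A \<omega> \<and> R (Z t \<omega>)) :: ennreal) \<in> borel_measurable lborel"
      by simp
    have m2: "(\<lambda>t. of_bool (0 \<le> t \<and> ennreal t < hitting_time Z A \<omega> \<and> R (Z t \<omega>)) :: real) \<in> borel_measurable lborel"
    proof -
      have "(\<lambda>t. enn2real (of_bool (0 \<le> t \<and> ennreal t < hitting_time Z A \<omega> \<and> R (Z t \<omega>)))) \<in> borel_measurable lborel"
        by measurable
      also have "(\<lambda>t. enn2real (of_bool (0 \<le> t \<and> ennreal t < hitting_time Z A \<omega> \<and> R (Z t \<omega>))))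
        = (\<lambda>t. of_bool (0 \<le> t \<and> ennreal t < hitting_time Z A \<omega> \<and> R (Z t \<omega>)))"
        by (auto simp: fun_eq_iff)
      finally show ?thesis .
    qed
    let ?g = "\<lambda>t. of_bool (0 \<le> t \<and> ennreal t < hitting_time Z A \<omega> \<and> R (Z t \<omega>)) :: real"
    \<comment> \<open>Closed and half-open intervals disagree only at \<open>t = T\<close>.\<close>
    have eq: "indicator {0..T} t *\<^sub>R of_bool (R (Z t \<omega>)) = (if t = T then of_bool (R (Z T \<omega>)) else ?g t)" for t
      using T by (auto simp: indicator_def ennreal_less_iff)
    have "?X \<omega> = (LINT t|lborel. (if t = T then of_bool (R (Z T \<omega>)) else ?g t))"
      unfolding set_lebesgue_integral_def T(1) enn2real_ennreal[OF T(2)] eq[unfolded T(1)] ..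
    also have "\<dots> = (LINT t|lborel. ?g t)"
    proof (rule integral_cong_AE)
      show "AE t in lborel. (if t = T then of_bool (R (Z T \<omega>)) else ?g t) = ?g t"
        using AE_lborel_singleton[of T] by eventually_elim simp
    qed (use m2 in measurable)
    also have "\<dots> = enn2real (\<integral>\<^sup>+t. ennreal (?g t) \<partial>lborel)"
      by (rule integral_eq_nn_integral) (use m2 in auto)
    also have "(\<integral>\<^sup>+t. ennreal (?g t) \<partial>lborel) = Y \<omega>"
      unfolding Y_def by (intro nn_integral_cong) auto
    finally show ?thesis using True by simp
  next
    case False
    \<comment> \<open>Here \<open>enn2real\<close> returns 0, so the interval of integration
      collapses to a point.\<close>
    then have "hitting_time Z A \<omega> = \<infinity>" using top.not_eq_extremum[of "hitting_time Z A \<omega>"] by auto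
    moreover have "(LINT t|lborel. indicator {0} t *\<^sub>R (of_bool (R (Z t \<omega>)) :: real)) = 0"
    proof (rule integral_eq_zero_AE)
      show "AE t in lborel. indicator {0} t *\<^sub>R (of_bool (R (Z t \<omega>)) :: real) = 0"
        using AE_lborel_singleton[of "0::real"] by eventually_elim auto
    qed
    ultimately show ?thesis by (simp add: set_lebesgue_integral_def)
  qed
  have "expectation ?X = expectation (\<lambda>\<omega>. if hitting_time Z A \<omega> < \<infinity> then enn2real (Y \<omega>) else 0)"
    by (rule Bochner_Integration.integral_cong[OF refl X_eq])
  also have "\<dots> = enn2real (\<integral>\<^sup>+\<omega>. ennreal (if hitting_time Z A \<omega> < \<infinity> then enn2real (Y \<omega>) else 0) \<partial>P i)"
    by (rule integral_eq_nn_integral) auto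
  also have "(\<integral>\<^sup>+\<omega>. ennreal (if hitting_time Z A \<omega> < \<infinity> then enn2real (Y \<omega>) else 0) \<partial>P i) = (\<integral>\<^sup>+\<omega>. Y \<omega> \<partial>P i)"
  proof (rule nn_integral_cong_AE)
    show "AE \<omega> in P i. ennreal (if hitting_time Z A \<omega> < \<infinity> then enn2real (Y \<omega>) else 0) = Y \<omega>"
      using AE_hitting_time_finite
    proof eventually_elim
      case (elim \<omega>)
      then have "Y \<omega> < top" using Y_finite[of \<omega>] by (simp add: le_less_trans)
      then show ?case using elim by simp
    qed
  qed
  also have "\<dots> = ennreal (\<Sum>j | R j. green i j)"
    unfolding Y_def nn_integral_before_hitting nn_integral_occupation_density by (simp add: green_nonneg)
  finally show ?thesis by (simp add: sum_nonneg green_nonneg)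
qed

end

section \<open>The Green function inverts the generator\<close>

context ctmc_family
begin

lemma killed_prob_tendsto:
  assumes "i \<notin> A" "j \<notin> A"
  shows "((\<lambda>t. killed_prob t i j) \<longlongrightarrow> of_bool (i = j)) (at_right 0)"
proof -
  have "((\<lambda>t. of_bool (i = j) + t * ((killed_prob t i j - of_bool (i = j)) / t))
      \<longlongrightarrow> of_bool (i = j) + 0 * generator q $ i $ j) (at_right 0)"
    by (intro tendsto_intros killed_prob_deriv assms)
  then have "((\<lambda>t. of_bool (i = j) + t * ((killed_prob t i j - of_bool (i = j)) / t)) \<longlongrightarrow> of_bool (i = j)) (at_right 0)"
    by simp
  then show ?thesis
  proof (rule Lim_transform_eventually)
    show "\<forall>\<^sub>F t in at_right 0. of_bool (i = j) + t * ((killed_prob t i j - of_bool (i = j)) / t) = killed_prob t i j"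
      using eventually_at_right_less[of 0] by eventually_elim simp
  qed
qed

lemma killed_prob_zero:
  assumes "i \<notin> A" "j \<notin> A"
  shows "killed_prob 0 i j = of_bool (i = j)"
proof -
  interpret ctmc "P i" q Z i by (rule chain)
  have "killed_prob 0 i j = prob {\<omega> \<in> space (P i). Z 0 \<omega> = j}"
    unfolding killed_prob_def using assms by (intro arg_cong[where f = prob]) auto
  then show ?thesis by (simp add: prob_initial)
qed

section \<open>Splitting the Green function at a small time\<close>

text \<open>The part of \<open>green\<close> that a time shift by \<open>r\<close> loses. Leaving
  the interval unbounded below is harmless, as the density vanishes at negative times.\<close>

definition short_occupation :: "real \<Rightarrow> 's \<Rightarrow> 's \<Rightarrow> real" where
  "short_occupation r i j = enn2real (\<integral>\<^sup>+t. occupation_density i j t * indicator {..<r} t \<partial>lborel)"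

text \<open>The average over \<open>[0, r)\<close> of a function that is right-continuous at 0 tends
  to its value there; continuity at other times plays no part in the estimate.\<close>

lemma short_occupation_tendsto:
  assumes ij: "i \<notin> A" "j \<notin> A"
  shows "((\<lambda>r. short_occupation r i j / r) \<longlongrightarrow> of_bool (i = j)) (at_right 0)"
proof (rule tendstoI)
  fix e :: real assume e: "0 < e"
  let ?d = "of_bool (i = j) :: real"
  have "eventually (\<lambda>t. dist (killed_prob t i j) ?d < e / 2) (at_right 0)"
    using killed_prob_tendsto[OF ij] e by (intro tendstoD) auto
  then obtain b where b: "0 < b" "\<And>t. 0 < t \<Longrightarrow> t < b \<Longrightarrow> dist (killed_prob t i j) ?d < e / 2"
    unfolding eventually_at_right_field by auto
  have near: "\<bar>killed_prob t i j - ?d\<bar> \<le> e / 2" if "0 \<le> t" "t < b" for t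
    using b(2)[of t] that e killed_prob_zero[OF ij] by (cases "t = 0") (auto simp: dist_real_def)
  have near_up: "killed_prob t i j \<le> ?d + e / 2" and near_low: "?d - e / 2 \<le> killed_prob t i j"
    if "0 \<le> t" "t < b" for t
    using near[OF that] by linarith+
  have "dist (short_occupation r i j / r) ?d < e" if r: "0 < r" "r < b" for r
  proof -
    let ?J = "\<integral>\<^sup>+t. occupation_density i j t * indicator {..<r} t \<partial>lborel"
    \<comment> \<open>Also for negative \<open>c\<close>, where both sides are 0: the lower bound
      \<open>?d - e / 2\<close> is negative when \<open>i \<noteq> j\<close>.\<close>
    have const: "(\<integral>\<^sup>+t. ennreal c * indicator {0..<r} t \<partial>lborel) = ennreal (c * r)" for c
      using r by (cases "0 \<le> c")
        (auto simp: nn_integral_cmult ennreal_mult ennreal_neg mult_nonpos_nonneg)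
    have "?J \<le> (\<integral>\<^sup>+t. ennreal (?d + e / 2) * indicator {0..<r} t \<partial>lborel)"
    proof (rule nn_integral_mono)
      fix t
      show "occupation_density i j t * indicator {..<r} t \<le> ennreal (?d + e / 2) * indicator {0..<r} t"
      proof (cases "t \<in> {0..<r}")
        case True
        then have "0 \<le> t" "t < b" "t < r" using r by auto
        then show ?thesis using True near_up[of t] by (simp add: occupation_density_def ennreal_leI)
      next
        case False
        then show ?thesis by (auto simp: occupation_density_def indicator_def)
      qed
    qed
    then have up: "?J \<le> ennreal ((?d + e / 2) * r)" unfolding const .
    have "(\<integral>\<^sup>+t. ennreal (?d - e / 2) * indicator {0..<r} t \<partial>lborel) \<le> ?J"
    proof (rule nn_integral_mono)
      fix t
      show "ennreal (?d - e / 2) * indicator {0..<r} t \<le> occupation_density i j t * indicator {..<r} t"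
      proof (cases "t \<in> {0..<r}")
        case True
        then have "0 \<le> t" "t < b" "t < r" using r by auto
        then show ?thesis using True near_low[of t] by (simp add: occupation_density_def ennreal_leI)
      next
        case False
        then show ?thesis by (auto simp: occupation_density_def indicator_def)
      qed
    qed
    then have low: "ennreal ((?d - e / 2) * r) \<le> ?J" unfolding const .
    have J: "?J = ennreal (short_occupation r i j)"
      using up unfolding short_occupation_def by (simp add: top_unique le_less_trans)
    have s: "0 \<le> short_occupation r i j" by (simp add: short_occupation_def)
    have "0 \<le> (?d + e / 2) * r" using e r by simp
    then have "short_occupation r i j \<le> (?d + e / 2) * r" using up s unfolding J by simp
    moreover have "(?d - e / 2) * r \<le> short_occupation r i j" using low s unfolding J
      by (cases "0 \<le> (?d - e / 2) * r") auto
    ultimately have "short_occupation r i j / r \<le> ?d + e / 2" "?d - e / 2 \<le> short_occupation r i j / r"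
      using r by (auto simp: divide_simps mult.commute)
    then have "\<bar>short_occupation r i j / r - ?d\<bar> \<le> e / 2" by linarith
    then show ?thesis using e unfolding dist_real_def by linarith
  qed
  then show "eventually (\<lambda>r. dist (short_occupation r i j / r) ?d < e) (at_right 0)"
    using b(1) unfolding eventually_at_right_field by blast
qed

lemma nn_integral_occupation_density_split:
  assumes "0 \<le> r"
  shows "(\<integral>\<^sup>+t. occupation_density i j t \<partial>lborel) =
    (\<integral>\<^sup>+t. occupation_density i j t * indicator {..<r} t \<partial>lborel)
    + (\<integral>\<^sup>+t. occupation_density i j (r + t) * indicator {0..} t \<partial>lborel)"
proof -
  have "(\<integral>\<^sup>+t. occupation_density i j t \<partial>lborel) =
    (\<integral>\<^sup>+t. occupation_density i j t * indicator {..<r} t + occupation_density i j t * indicator {r..} t \<partial>lborel)"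
    by (intro nn_integral_cong) (auto simp: indicator_def)
  also have "\<dots> = (\<integral>\<^sup>+t. occupation_density i j t * indicator {..<r} t \<partial>lborel)
      + (\<integral>\<^sup>+t. occupation_density i j t * indicator {r..} t \<partial>lborel)"
    by (rule nn_integral_add) measurable
  also have "(\<integral>\<^sup>+t. occupation_density i j t * indicator {r..} t \<partial>lborel)
     = (\<integral>\<^sup>+t. occupation_density i j (r + 1 * t) * indicator {r..} (r + 1 * t) \<partial>lborel)"
    by (subst nn_integral_real_affine[of _ 1 r]) auto
  also have "\<dots> = (\<integral>\<^sup>+t. occupation_density i j (r + t) * indicator {0..} t \<partial>lborel)"
    by (intro nn_integral_cong) (auto simp: indicator_def)
  finally show ?thesis .
qed

end

context finite_mean_hitting
begin

lemma short_occupation_finite: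
  "(\<integral>\<^sup>+t. occupation_density i j t * indicator {..<r} t \<partial>lborel) = ennreal (short_occupation r i j)"
proof -
  have "(\<integral>\<^sup>+t. occupation_density i j t * indicator {..<r} t \<partial>lborel) \<le> (\<integral>\<^sup>+t. occupation_density i j t \<partial>lborel)"
    by (intro nn_integral_mono) (auto simp: indicator_def)
  then have "(\<integral>\<^sup>+t. occupation_density i j t * indicator {..<r} t \<partial>lborel) < top"
    unfolding nn_integral_occupation_density by (simp add: le_less_trans)
  then show ?thesis by (simp add: short_occupation_def)
qed

lemma green_eq_short_plus:
  assumes r: "0 \<le> r"
    and later: "(\<integral>\<^sup>+t. occupation_density i j (r + t) * indicator {0..} t \<partial>lborel) = ennreal c" and "0 \<le> c"
  shows "green i j = short_occupation r i j + c"
proof -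
  have s: "0 \<le> short_occupation r i j" by (simp add: short_occupation_def)
  have "ennreal (green i j) = ennreal (short_occupation r i j) + ennreal c"
    using nn_integral_occupation_density_split[OF r, of i j]
    unfolding later short_occupation_finite nn_integral_occupation_density .
  also have "\<dots> = ennreal (short_occupation r i j + c)"
    using s \<open>0 \<le> c\<close> by (rule ennreal_plus[symmetric])
  finally show ?thesis
    by (subst (asm) ennreal_inj) (use s \<open>0 \<le> c\<close> green_nonneg in auto)
qed

text \<open>The time \<open>t + r\<close> is traversed with \<open>r\<close> last, which puts
  \<open>killed_prob r\<close> on the right; traversing \<open>r\<close> first gives
  \<open>green_split_left\<close>.\<close>

lemma green_split_right:
  assumes r: "0 \<le> r"
  shows "green i j = short_occupation r i j + (\<Sum>x\<in>UNIV. green i x * killed_prob r x j)"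
proof (rule green_eq_short_plus[OF r])
  have "(\<integral>\<^sup>+t. occupation_density i j (r + t) * indicator {0..} t \<partial>lborel)
    = (\<integral>\<^sup>+t. (\<Sum>x\<in>UNIV. occupation_density i x t * ennreal (killed_prob r x j)) \<partial>lborel)"
  proof (rule nn_integral_cong)
    fix t
    show "occupation_density i j (r + t) * indicator {0..} t = (\<Sum>x\<in>UNIV. occupation_density i x t * ennreal (killed_prob r x j))"
    proof (cases "0 \<le> t")
      case True
      then show ?thesis using occupation_density_add[OF True r, of i j] r
        by (simp add: add.commute) (simp add: occupation_density_def)
    qed (simp add: occupation_density_def)
  qed
  also have "\<dots> = ennreal (\<Sum>x\<in>UNIV. green i x * killed_prob r x j)"
    by (simp add: nn_integral_sum nn_integral_multc nn_integral_occupation_density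
      ennreal_mult[symmetric] green_nonneg killed_prob_nonneg)
  finally show "(\<integral>\<^sup>+t. occupation_density i j (r + t) * indicator {0..} t \<partial>lborel) = \<dots>" .
qed (intro sum_nonneg mult_nonneg_nonneg green_nonneg killed_prob_nonneg)

lemma green_split_left:
  assumes r: "0 \<le> r"
  shows "green i j = short_occupation r i j + (\<Sum>x\<in>UNIV. killed_prob r i x * green x j)"
proof (rule green_eq_short_plus[OF r])
  have "(\<integral>\<^sup>+t. occupation_density i j (r + t) * indicator {0..} t \<partial>lborel)
    = (\<integral>\<^sup>+t. (\<Sum>x\<in>UNIV. ennreal (killed_prob r i x) * occupation_density x j t) \<partial>lborel)"
  proof (rule nn_integral_cong)
    fix t
    show "occupation_density i j (r + t) * indicator {0..} t = (\<Sum>x\<in>UNIV. ennreal (killed_prob r i x) * occupation_density x j t)"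
    proof (cases "0 \<le> t")
      case True
      then show ?thesis using occupation_density_add[OF r True, of i j] r
        by simp (simp add: occupation_density_def)
    qed (simp add: occupation_density_def)
  qed
  also have "\<dots> = ennreal (\<Sum>x\<in>UNIV. killed_prob r i x * green x j)"
    by (simp add: nn_integral_sum nn_integral_cmult nn_integral_occupation_density
      ennreal_mult[symmetric] green_nonneg killed_prob_nonneg)
  finally show "(\<integral>\<^sup>+t. occupation_density i j (r + t) * indicator {0..} t \<partial>lborel) = \<dots>" .
qed (intro sum_nonneg mult_nonneg_nonneg green_nonneg killed_prob_nonneg)

lemma green_generator:
  assumes ij: "i \<notin> A" "j \<notin> A"
  shows "(\<Sum>x\<in>UNIV. green i x * generator q $ x $ j) = - of_bool (i = j)"
proof (rule tendsto_unique[OF trivial_limit_at_right_real])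
  show "((\<lambda>r. \<Sum>x\<in>UNIV. green i x * ((killed_prob r x j - of_bool (x = j)) / r))
      \<longlongrightarrow> (\<Sum>x\<in>UNIV. green i x * generator q $ x $ j)) (at_right 0)"
  proof (rule tendsto_sum)
    fix x
    show "((\<lambda>r. green i x * ((killed_prob r x j - of_bool (x = j)) / r)) \<longlongrightarrow> green i x * generator q $ x $ j) (at_right 0)"
    \<comment> \<open>The limit of the difference quotient is known only off \<open>A\<close>; on
      \<open>A\<close> the factor \<open>green i x\<close> is 0.\<close>
    proof (cases "x \<in> A")
      case False
      then show ?thesis by (intro tendsto_mult tendsto_const killed_prob_deriv ij)
    qed (simp add: green_eq_0)
  qed
  have "((\<lambda>r. - (short_occupation r i j / r)) \<longlongrightarrow> - of_bool (i = j)) (at_right 0)"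
    by (intro tendsto_minus short_occupation_tendsto ij)
  then show "((\<lambda>r. \<Sum>x\<in>UNIV. green i x * ((killed_prob r x j - of_bool (x = j)) / r)) \<longlongrightarrow> - of_bool (i = j)) (at_right 0)"
  proof (rule Lim_transform_eventually)
    show "\<forall>\<^sub>F r in at_right 0. - (short_occupation r i j / r)
      = (\<Sum>x\<in>UNIV. green i x * ((killed_prob r x j - of_bool (x = j)) / r))"
      using eventually_at_right_less[of 0]
    proof eventually_elim
      case (elim r)
      have "(\<Sum>x\<in>UNIV. green i x * ((killed_prob r x j - of_bool (x = j)) / r))
        = ((\<Sum>x\<in>UNIV. green i x * killed_prob r x j) - (\<Sum>x\<in>UNIV. green i x * of_bool (x = j))) / r"
        by (simp only: sum_divide_distrib[symmetric] times_divide_eq_right times_divide_eq_left right_diff_distrib sum_subtractf)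
      also have "(\<Sum>x\<in>UNIV. green i x * of_bool (x = j)) = green i j" by simp
      finally show ?case using green_split_right[of r i j] elim by (simp add: divide_simps)
    qed
  qed
qed

lemma generator_green:
  assumes ij: "i \<notin> A" "j \<notin> A"
  shows "(\<Sum>x\<in>UNIV. generator q $ i $ x * green x j) = - of_bool (i = j)"
proof (rule tendsto_unique[OF trivial_limit_at_right_real])
  show "((\<lambda>r. \<Sum>x\<in>UNIV. ((killed_prob r i x - of_bool (i = x)) / r) * green x j)
      \<longlongrightarrow> (\<Sum>x\<in>UNIV. generator q $ i $ x * green x j)) (at_right 0)"
  proof (rule tendsto_sum)
    fix x
    show "((\<lambda>r. ((killed_prob r i x - of_bool (i = x)) / r) * green x j) \<longlongrightarrow> generator q $ i $ x * green x j) (at_right 0)"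
    proof (cases "x \<in> A")
      case False
      then show ?thesis by (intro tendsto_mult tendsto_const killed_prob_deriv ij)
    qed (simp add: green_eq_0)
  qed
  have "((\<lambda>r. - (short_occupation r i j / r)) \<longlongrightarrow> - of_bool (i = j)) (at_right 0)"
    by (intro tendsto_minus short_occupation_tendsto ij)
  then show "((\<lambda>r. \<Sum>x\<in>UNIV. ((killed_prob r i x - of_bool (i = x)) / r) * green x j) \<longlongrightarrow> - of_bool (i = j)) (at_right 0)"
  proof (rule Lim_transform_eventually)
    show "\<forall>\<^sub>F r in at_right 0. - (short_occupation r i j / r)
      = (\<Sum>x\<in>UNIV. ((killed_prob r i x - of_bool (i = x)) / r) * green x j)"
      using eventually_at_right_less[of 0]
    proof eventually_elim
      case (elim r)
      have "(\<Sum>x\<in>UNIV. ((killed_prob r i x - of_bool (i = x)) / r) * green x j)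
        = ((\<Sum>x\<in>UNIV. killed_prob r i x * green x j) - (\<Sum>x\<in>UNIV. of_bool (i = x) * green x j)) / r"
        by (simp only: sum_divide_distrib[symmetric] times_divide_eq_right times_divide_eq_left left_diff_distrib sum_subtractf)
      also have "(\<Sum>x\<in>UNIV. of_bool (i = x) * green x j) = green i j" by (simp add: sum_of_bool_mult_eq)
      finally show ?case using green_split_left[of r i j] elim by (simp add: divide_simps)
    qed
  qed
qed

end

section \<open>The variance bound\<close>

text \<open>Rows of the generator sum to 0, so it acts on increments of \<open>f\<close>.\<close>

lemma sum_generator:
  "(\<Sum>x\<in>UNIV. generator q $ i $ x * f x) = (\<Sum>k\<in>UNIV - {i}. q i k * (f k - f i))"
proof -
  have "(\<Sum>x\<in>UNIV. generator q $ i $ x * f x)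
    = generator q $ i $ i * f i + (\<Sum>x\<in>UNIV - {i}. generator q $ i $ x * f x)"
    by (rule sum.remove) auto
  also have "(\<Sum>x\<in>UNIV - {i}. generator q $ i $ x * f x) = (\<Sum>x\<in>UNIV - {i}. q i x * f x)"
    by (intro sum.cong) (auto simp: generator_def)
  also have "generator q $ i $ i = - (\<Sum>k\<in>UNIV - {i}. q i k)"
    by (simp add: generator_def)
  finally show ?thesis
    by (simp add: right_diff_distrib sum_subtractf sum_distrib_right)
qed

context finite_mean_hitting
begin

definition mean_hit :: "'s \<Rightarrow> real" where
  "mean_hit i = (\<Sum>j\<in>UNIV. green i j)"

lemma mean_hit_nonneg: "0 \<le> mean_hit i"
  by (simp add: mean_hit_def sum_nonneg green_nonneg)

lemma mean_hit_eq_0: "i \<in> A \<Longrightarrow> mean_hit i = 0"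
  by (simp add: mean_hit_def green_eq_0)

text \<open>Sum \<open>generator_green\<close> over its columns. Read as a normalization: off
  \<open>A\<close> the rate-weighted drops of the mean hitting time add up to 1.\<close>

lemma mean_hit_drift:
  assumes i: "i \<notin> A"
  shows "(\<Sum>k\<in>UNIV - {i}. q i k * (mean_hit i - mean_hit k)) = 1"
proof -
  have "(\<Sum>k\<in>UNIV - {i}. q i k * (mean_hit k - mean_hit i)) = (\<Sum>x\<in>UNIV. generator q $ i $ x * mean_hit x)"
    by (rule sum_generator[symmetric])
  also have "\<dots> = (\<Sum>j\<in>UNIV. \<Sum>x\<in>UNIV. generator q $ i $ x * green x j)"
    unfolding mean_hit_def sum_distrib_left by (rule sum.swap)
  also have "\<dots> = (\<Sum>j\<in>UNIV. if i = j then -1 else 0)"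
  proof (rule sum.cong[OF refl])
    fix j
    show "(\<Sum>x\<in>UNIV. generator q $ i $ x * green x j) = (if i = j then -1 else 0)"
      using i generator_green[OF i, of j] by (cases "j \<in> A") (auto simp: green_eq_0)
  qed
  also have "\<dots> = -1" by simp
  finally show ?thesis
    by (simp add: right_diff_distrib sum_subtractf)
qed

text \<open>Dynkin's formula at the hitting time; the boundary term is absent because
  \<open>f\<close> vanishes on \<open>A\<close>.\<close>

lemma green_drift:
  assumes i: "i \<notin> A" and f: "\<And>x. x \<in> A \<Longrightarrow> f x = 0"
  shows "(\<Sum>x\<in>UNIV. green i x * (\<Sum>k\<in>UNIV - {x}. q x k * (f k - f x))) = - f i"
proof -
  have "(\<Sum>x\<in>UNIV. green i x * (\<Sum>k\<in>UNIV - {x}. q x k * (f k - f x)))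
    = (\<Sum>x\<in>UNIV. \<Sum>j\<in>UNIV. green i x * generator q $ x $ j * f j)"
    by (simp only: sum_generator[symmetric] sum_distrib_left mult.assoc)
  also have "\<dots> = (\<Sum>j\<in>UNIV. (\<Sum>x\<in>UNIV. green i x * generator q $ x $ j) * f j)"
    unfolding sum_distrib_right by (rule sum.swap)
  also have "\<dots> = (\<Sum>j\<in>UNIV. if i = j then - f i else 0)"
  proof (rule sum.cong[OF refl])
    fix j
    show "(\<Sum>x\<in>UNIV. green i x * generator q $ x $ j) * f j = (if i = j then - f i else 0)"
      using i f green_generator[OF i, of j] by (cases "j \<in> A") auto
  qed
  finally show ?thesis by simp
qed

lemma rates_nonneg: "i \<noteq> j \<Longrightarrow> 0 \<le> q i j"
  by (rule ctmc.rates_nonneg[OF chain])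

lemma variance_hitting_time:
  assumes i: "i \<notin> A"
  shows "prob_space.variance (P i) (\<lambda>\<omega>. enn2real (hitting_time Z A \<omega>))
    = (\<Sum>x\<in>UNIV. green i x * (\<Sum>k\<in>UNIV - {x}. q x k * (mean_hit x - mean_hit k)\<^sup>2))"
proof -
  interpret ctmc "P i" q Z i by (rule chain)
  have int2: "integrable (P i) (\<lambda>\<omega>. (enn2real (hitting_time Z A \<omega>))\<^sup>2)"
    by (rule second_moment_hitting_time)
  have int1: "integrable (P i) (\<lambda>\<omega>. enn2real (hitting_time Z A \<omega>))"
    by (rule square_integrable_imp_integrable[OF _ int2]) measurable
  have "variance (\<lambda>\<omega>. enn2real (hitting_time Z A \<omega>)) = 2 * (\<Sum>x\<in>UNIV. green i x * mean_hit x) - (mean_hit i)\<^sup>2"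
    using variance_eq[OF int1 int2]
    by (simp add: second_moment_hitting_time(2) expectation_hitting_time mean_hit_def)
  \<comment> \<open>Dynkin's formula for the square of the mean hitting time turns
    \<open>- (mean_hit i)^2\<close> into a Green sum as well.\<close>
  also have "\<dots> = (\<Sum>x\<in>UNIV. green i x * (2 * mean_hit x))
      + (\<Sum>x\<in>UNIV. green i x * (\<Sum>k\<in>UNIV - {x}. q x k * ((mean_hit k)\<^sup>2 - (mean_hit x)\<^sup>2)))"
    using green_drift[OF i, of "\<lambda>x. (mean_hit x)\<^sup>2"] by (simp add: mean_hit_eq_0 sum_distrib_left mult_ac)
  also have "\<dots> = (\<Sum>x\<in>UNIV. green i x * (2 * mean_hit x + (\<Sum>k\<in>UNIV - {x}. q x k * ((mean_hit k)\<^sup>2 - (mean_hit x)\<^sup>2))))"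
    by (simp add: sum.distrib[symmetric] distrib_left)
  also have "\<dots> = (\<Sum>x\<in>UNIV. green i x * (\<Sum>k\<in>UNIV - {x}. q x k * (mean_hit x - mean_hit k)\<^sup>2))"
  proof (rule sum.cong[OF refl])
    fix x
    show "green i x * (2 * mean_hit x + (\<Sum>k\<in>UNIV - {x}. q x k * ((mean_hit k)\<^sup>2 - (mean_hit x)\<^sup>2)))
      = green i x * (\<Sum>k\<in>UNIV - {x}. q x k * (mean_hit x - mean_hit k)\<^sup>2)"
    proof (cases "x \<in> A")
      case False
      \<comment> \<open>Multiplying by the unit drift completes the square:
        \<open>2 * a * (a - b) + b^2 - a^2 = (a - b)^2\<close>.\<close>
      have "2 * mean_hit x = 2 * mean_hit x * (\<Sum>k\<in>UNIV - {x}. q x k * (mean_hit x - mean_hit k))"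
        using mean_hit_drift[OF False] by simp
      then have "2 * mean_hit x + (\<Sum>k\<in>UNIV - {x}. q x k * ((mean_hit k)\<^sup>2 - (mean_hit x)\<^sup>2))
        = (\<Sum>k\<in>UNIV - {x}. 2 * mean_hit x * (q x k * (mean_hit x - mean_hit k)) + q x k * ((mean_hit k)\<^sup>2 - (mean_hit x)\<^sup>2))"
        by (simp only: sum.distrib sum_distrib_left)
      also have "\<dots> = (\<Sum>k\<in>UNIV - {x}. q x k * (mean_hit x - mean_hit k)\<^sup>2)"
        by (intro sum.cong refl) (simp add: power2_eq_square algebra_simps)
      finally show ?thesis by simp
    qed (simp add: green_eq_0)
  qed
  finally show ?thesis .
qed

text \<open>The chain started at \<open>i\<close> spends no time above level \<open>mean_hit i\<close>: the truncation of the mean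
  hitting time to the states above this level vanishes at \<open>i\<close>, but drifts down at rate at least one
  on these states.\<close>

lemma green_pos_imp_mean_hit_le:
  assumes mono: "\<And>x y. x \<noteq> y \<Longrightarrow> 0 < q x y \<Longrightarrow> mean_hit y \<le> mean_hit x"
    and pos: "0 < green i j"
  shows "mean_hit j \<le> mean_hit i"
proof (rule ccontr)
  assume j: "\<not> mean_hit j \<le> mean_hit i"
  have i: "i \<notin> A" using pos green_eq_0[of i j] by auto
  define f where "f x = (if mean_hit x \<le> mean_hit i then 0 else mean_hit x)" for x
  define L where "L x = (\<Sum>k\<in>UNIV - {x}. q x k * (f k - f x))" for x
  have low: "L x = 0" if "mean_hit x \<le> mean_hit i" for x
    unfolding L_def
  proof (intro sum.neutral ballI)
    fix k assume k: "k \<in> UNIV - {x}"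
    show "q x k * (f k - f x) = 0"
    proof (cases "q x k = 0")
      case False
      then have "0 < q x k" using rates_nonneg[of x k] k by auto
      then have "mean_hit k \<le> mean_hit x" using mono k by auto
      then show ?thesis using that by (simp add: f_def)
    qed simp
  qed
  have high: "L x \<le> -1" if x: "\<not> mean_hit x \<le> mean_hit i" for x
  proof -
    have "x \<notin> A" using x mean_hit_eq_0[of x] mean_hit_nonneg[of i] by auto
    \<comment> \<open>Above the level, truncation leaves the value at \<open>x\<close> unchanged and
      can only lower the values at its neighbours.\<close>
    have "L x \<le> (\<Sum>k\<in>UNIV - {x}. q x k * (mean_hit k - mean_hit x))"
      unfolding L_def
      by (intro sum_mono mult_left_mono rates_nonneg) (use x mean_hit_nonneg in \<open>auto simp: f_def\<close>)
    also have "\<dots> = - (\<Sum>k\<in>UNIV - {x}. q x k * (mean_hit x - mean_hit k))"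
      by (simp add: sum_negf[symmetric] right_diff_distrib)
    also have "\<dots> = -1" using mean_hit_drift[OF \<open>x \<notin> A\<close>] by simp
    finally show ?thesis .
  qed
  have nonpos: "L x \<le> 0" for x using low high[of x] by (cases "mean_hit x \<le> mean_hit i") auto
  have "f x = 0" if "x \<in> A" for x
    using that by (simp add: f_def mean_hit_eq_0)
  then have "(\<Sum>x\<in>UNIV. green i x * L x) = - f i"
    unfolding L_def by (intro green_drift i)
  \<comment> \<open>A vanishing sum of nonnegative terms, while the term at \<open>j\<close> would
    be positive.\<close>
  then have "(\<Sum>x\<in>UNIV. green i x * - L x) = 0" by (simp add: f_def sum_negf)
  moreover have "green i j * - L j \<le> (\<Sum>x\<in>UNIV. green i x * - L x)"
    using nonpos green_nonneg by (intro member_le_sum mult_nonneg_nonneg) auto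
  moreover have "0 < green i j * - L j"
    using pos high[OF j] by (intro mult_pos_pos) auto
  ultimately show False by linarith
qed

text \<open>Drops of size at most \<open>\<delta> * m\<close> have total rate-weighted size at most one; a larger drop
  is at most \<open>mean_hit x \<le> m\<close>.\<close>

lemma squared_drop_rate_le:
  assumes mono: "\<And>x y. x \<noteq> y \<Longrightarrow> 0 < q x y \<Longrightarrow> mean_hit y \<le> mean_hit x"
    and x: "x \<notin> A" and m: "mean_hit x \<le> m" and "0 \<le> \<delta>" "0 \<le> \<epsilon>"
  shows "(\<Sum>k\<in>UNIV - {x}. q x k * (mean_hit x - mean_hit k)\<^sup>2)
    \<le> m * (\<delta> + \<epsilon> + of_bool (\<epsilon> \<le> large_drop_rate q mean_hit m \<delta> x))"
proof -
  define d where "d k = q x k * (mean_hit x - mean_hit k)" for k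
  let ?B = "{k. k \<noteq> x \<and> mean_hit x - mean_hit k > \<delta> * m}"
  let ?S = "{k. k \<noteq> x \<and> \<not> mean_hit x - mean_hit k > \<delta> * m}"
  have U: "UNIV - {x} = ?S \<union> ?B" "?S \<inter> ?B = {}" by auto
  have m0: "0 \<le> m" using m mean_hit_nonneg[of x] by linarith
  have d: "0 \<le> d k" if "k \<noteq> x" for k
  proof (cases "q x k = 0")
    case False
    then have "0 < q x k" using rates_nonneg[of x k] that by auto
    then show ?thesis using mono[of x k] that by (simp add: d_def)
  qed (simp add: d_def)
  have total: "sum d ?S + sum d ?B = 1"
    using mean_hit_drift[OF x] unfolding U(1) by (subst sum.union_disjoint[symmetric]) (auto simp: d_def)
  have large: "sum d ?B = large_drop_rate q mean_hit m \<delta> x"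
    by (simp add: large_drop_rate_def d_def)
  have nonneg: "0 \<le> sum d ?S" "0 \<le> sum d ?B" using d by (auto intro!: sum_nonneg)
  have "(\<Sum>k\<in>UNIV - {x}. q x k * (mean_hit x - mean_hit k)\<^sup>2)
    = (\<Sum>k\<in>?S. d k * (mean_hit x - mean_hit k)) + (\<Sum>k\<in>?B. d k * (mean_hit x - mean_hit k))"
    unfolding U(1) by (subst sum.union_disjoint[symmetric]) (auto simp: d_def power2_eq_square mult_ac)
  also have "\<dots> \<le> (\<Sum>k\<in>?S. d k * (\<delta> * m)) + (\<Sum>k\<in>?B. d k * m)"
  proof (intro add_mono sum_mono mult_left_mono)
    show "mean_hit x - mean_hit k \<le> m" for k using m mean_hit_nonneg[of k] by linarith
  qed (auto intro: d)
  also have "\<dots> = m * (\<delta> * sum d ?S + sum d ?B)"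
    by (simp only: sum_distrib_right[symmetric]) (simp add: distrib_left mult_ac)
  also have "\<dots> \<le> m * (\<delta> + \<epsilon> + of_bool (\<epsilon> \<le> large_drop_rate q mean_hit m \<delta> x))"
  proof (intro mult_left_mono m0)
    have "\<delta> * sum d ?S \<le> \<delta> * 1" using total nonneg \<open>0 \<le> \<delta>\<close> by (intro mult_left_mono) auto
    \<comment> \<open>Either the large drops have rate below \<open>\<epsilon>\<close>, or the
      indicator is 1 and the total weight 1 bounds them.\<close>
    moreover have "sum d ?B \<le> \<epsilon> + of_bool (\<epsilon> \<le> large_drop_rate q mean_hit m \<delta> x)"
      using total nonneg large \<open>0 \<le> \<epsilon>\<close> by auto
    ultimately show "\<delta> * sum d ?S + sum d ?B \<le> \<delta> + \<epsilon> + of_bool (\<epsilon> \<le> large_drop_rate q mean_hit m \<delta> x)"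
      by linarith
  qed
  finally show ?thesis .
qed

end

theorem lemma2:
  fixes q :: "'s::finite \<Rightarrow> 's \<Rightarrow> real"
    and P :: "'s \<Rightarrow> 'w measure"
    and Z :: "real \<Rightarrow> 'w \<Rightarrow> 's"
    and \<Sigma>0 :: "'s set"
    and h :: "'s \<Rightarrow> real"
    and T :: "'w \<Rightarrow> real"
    and S0 :: 's
    and \<delta> \<epsilon> :: real
  assumes chain: "\<And>S. ctmc (P S) q Z S"
    and finite_mean: "\<And>S. (\<integral>\<^sup>+\<omega>. hitting_time Z \<Sigma>0 \<omega> \<partial>P S) < \<infinity>"
    and h_eq: "\<And>S. h S = enn2real (\<integral>\<^sup>+\<omega>. hitting_time Z \<Sigma>0 \<omega> \<partial>P S)"
    and T_eq: "\<And>\<omega>. T \<omega> = enn2real (hitting_time Z \<Sigma>0 \<omega>)"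
    and mono: "\<And>S S'. S \<noteq> S' \<Longrightarrow> 0 < q S S' \<Longrightarrow> h S' \<le> h S"
    and initial: "S0 \<notin> \<Sigma>0"
    and "0 < \<delta>" and "0 < \<epsilon>"
  shows "integrable (P S0) (\<lambda>\<omega>. (T \<omega>)\<^sup>2) \<and>
    prob_space.variance (P S0) T / (prob_space.expectation (P S0) T)\<^sup>2
      \<le> \<delta> + \<epsilon> +
        prob_space.expectation (P S0)
          (\<lambda>\<omega>. LINT u:{0..T \<omega>}|lborel.
             of_bool (\<epsilon> \<le> large_drop_rate q h (prob_space.expectation (P S0) T) \<delta> (Z u \<omega>)))
        / prob_space.expectation (P S0) T"
proof
  interpret finite_mean_hitting P q Z \<Sigma>0
    by (intro finite_mean_hitting.intro ctmc_family.intro finite_mean_hitting_axioms.intro chain finite_mean)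
  have T: "T = (\<lambda>\<omega>. enn2real (hitting_time Z \<Sigma>0 \<omega>))" using T_eq by auto
  have h: "h = mean_hit"
    by (auto simp: fun_eq_iff h_eq mean_hitting_time mean_hit_def sum_nonneg green_nonneg)
  have mono': "mean_hit y \<le> mean_hit x" if "x \<noteq> y" "0 < q x y" for x y
    using mono that unfolding h .
  define m where "m = prob_space.expectation (P S0) T"
  have m: "m = mean_hit S0" unfolding m_def T expectation_hitting_time mean_hit_def ..
  define b where "b x = (of_bool (\<epsilon> \<le> large_drop_rate q h m \<delta> x) :: real)" for x
  define I where "I = prob_space.expectation (P S0) (\<lambda>\<omega>. LINT u:{0..T \<omega>}|lborel. b (Z u \<omega>))"
  have I: "I = (\<Sum>x\<in>UNIV. green S0 x * b x)"
    unfolding I_def T b_def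
      expectation_occupation_time[where R = "\<lambda>x. \<epsilon> \<le> large_drop_rate q h m \<delta> x"]
    by (simp add: sum_mult_of_bool_eq)
  show "integrable (P S0) (\<lambda>\<omega>. (T \<omega>)\<^sup>2)"
    unfolding T by (rule second_moment_hitting_time)
  have "prob_space.variance (P S0) T
    = (\<Sum>x\<in>UNIV. green S0 x * (\<Sum>k\<in>UNIV - {x}. q x k * (mean_hit x - mean_hit k)\<^sup>2))"
    unfolding T by (rule variance_hitting_time[OF initial])
  also have "\<dots> \<le> (\<Sum>x\<in>UNIV. green S0 x * (m * (\<delta> + \<epsilon> + b x)))"
  proof (rule sum_mono)
    fix x
    show "green S0 x * (\<Sum>k\<in>UNIV - {x}. q x k * (mean_hit x - mean_hit k)\<^sup>2) \<le> green S0 x * (m * (\<delta> + \<epsilon> + b x))"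
    proof (cases "green S0 x = 0")
      \<comment> \<open>Only states that the chain visits with positive expected time matter, and
        these lie at level at most \<open>m\<close>.\<close>
      case False
      then have pos: "0 < green S0 x" using green_nonneg[of S0 x] by simp
      have "mean_hit x \<le> m"
        unfolding m by (rule green_pos_imp_mean_hit_le[OF mono' pos])
      moreover have "x \<notin> \<Sigma>0" using False green_eq_0 by blast
      ultimately show ?thesis
        unfolding b_def h using \<open>0 < \<delta>\<close> \<open>0 < \<epsilon>\<close> mono'
        by (intro mult_left_mono squared_drop_rate_le green_nonneg) auto
    qed simp
  qed
  also have "\<dots> = (\<Sum>x\<in>UNIV. green S0 x * (m * (\<delta> + \<epsilon>)) + green S0 x * b x * m)"
    by (intro sum.cong refl) (simp add: algebra_simps)
  also have "\<dots> = m\<^sup>2 * (\<delta> + \<epsilon>) + I * m"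
    by (simp only: sum.distrib sum_distrib_right[symmetric] I[symmetric] mean_hit_def[symmetric] m[symmetric])
       (simp add: power2_eq_square)
  finally have var: "prob_space.variance (P S0) T \<le> m\<^sup>2 * (\<delta> + \<epsilon>) + I * m" .
  \<comment> \<open>In the case \<open>m = 0\<close> every quotient is 0 by the convention
    \<open>x / 0 = 0\<close>.\<close>
  have "prob_space.variance (P S0) T / m\<^sup>2 \<le> \<delta> + \<epsilon> + I / m"
  proof (cases "m = 0")
    case False
    then have "0 < m\<^sup>2" by simp
    moreover have "m\<^sup>2 * (\<delta> + \<epsilon>) + I * m = (\<delta> + \<epsilon> + I / m) * m\<^sup>2"
      using False by (simp add: field_simps power2_eq_square)
    ultimately show ?thesis using var by (simp add: pos_divide_le_eq)
  qed (use \<open>0 < \<delta>\<close> \<open>0 < \<epsilon>\<close> in simp)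
  then show "prob_space.variance (P S0) T / (prob_space.expectation (P S0) T)\<^sup>2
      \<le> \<delta> + \<epsilon> +
        prob_space.expectation (P S0)
          (\<lambda>\<omega>. LINT u:{0..T \<omega>}|lborel.
             of_bool (\<epsilon> \<le> large_drop_rate q h (prob_space.expectation (P S0) T) \<delta> (Z u \<omega>)))
        / prob_space.expectation (P S0) T"
    unfolding I_def b_def m_def .
qed

end
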